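(* Suppose that $f:\mathbb{R}^d\to\mathbb{R}$ is convex and twice continuously differentiable with a minimizer $x^*$, that the symmetric Hessian approximation satisfies $\|H(x)-\nabla^2 f(x)\|\le\delta$ for all $x$, and that $f$ satisfies either the global or the local generalized Hessian smoothness condition (with constants $M_0,M_1\ge 0$, and radius $\rho>0$ in the local case). Let $R=\|x_0-x^*\|$, $$B=\max\{1,(6\sqrt{M_1}R)^{2/3},(2R/\rho)^{2/3}\},\qquad \varepsilon_{\rm tr}=\max\{48M_0R^3/B^{7/2},\,16\delta R^2/B^2\},$$ $$\overline\tau_0=\max\{4\delta,\,2\sqrt{L(x_0)\|\nabla f(x_0)\|},\,2\|\nabla f(x_0)\|/\rho\}.$$ There are universal constants $C,c>0$ such that the following hold for the adaptive damped A-NPE method started from $x_0$ with any $\eta_0>0$. (i) For every $\varepsilon>0$, the method generates an iterate $w_N$ satisfying $f(w_N)-f^*\le\varepsilon$ within $$N\le C\left(B\Big(1+\log_+\frac{\max\{\eta_0,\overline\tau_0\}R^2}{\max\{\varepsilon,\varepsilon_{\rm tr}\}}\Big)+\Big(\frac{M_0R^3}{\varepsilon}\Big)^{2/7}+\sqrt{\frac{\delta R^2}{\varepsilon}}\right)$$ outer iterations. (ii) There exists $K\ge1$ with $K\le C\,B\max\big\{1,\log\frac{\max\{\eta_0,\overline\tau_0\}R^2}{\varepsilon_{\rm tr}}\big\}$ such that $$f(w_k)-f^*\le C\max\{\eta_0,\overline\tau_0\}R^2\exp\Big(-\frac{c(k-1)}{B}\Big),\qquad 1\le k<K,$$ $$f(w_{K+n})-f^*\le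 C\left(\frac{M_0R^3}{(B+n)^{7/2}}+\frac{\delta R^2}{(B+n)^2}\right),\qquad n=0,1,\ldots.$$
   Context: $\|\cdot\|$ is the Euclidean norm for vectors and the induced operator norm for matrices; $f^*=f(x^* )$; $\log_+t=\max\{0,\log t\}$ (equal to $0$ at $t=0$). Conventions: $a/(+\infty)=0$ for finite $a\ge0$ and $a/0=+\infty$ for $a>0$. Put $L(x)=M_0+M_1\|\nabla f(x)\|$. Global generalized Hessian smoothness: $\|\nabla^2f(y)-\nabla^2f(x)\|\le L(x)\|y-x\|$ for all $x,y\in\mathbb{R}^d$; in this case set $\rho=+\infty$. Local generalized Hessian smoothness with radius $\rho>0$: the same inequality for all $x,y$ with $\|y-x\|\le\rho$. Procedure $\mathrm{MSBacktrack}(x,\tau)$ (for $x\in\mathbb{R}^d$, $\tau>0$): repeat the following trial. If $H(x)+\tau I\succ0$, solve $(H(x)+\tau I)s=-\nabla f(x)$; if moreover $\|\nabla f(x+s)+\tau s\|\le\frac{\tau}{2}\|s\|$, return the pair $(x+s,\tau)$. Otherwise (trial rejected) replace $\tau$ by $2\tau$. Adaptive damped A-NPE method. Input $x_0\in\mathbb{R}^d$, $\eta_0>0$. Set $(w_1,\eta_1)=\mathrm{MSBacktrack}(x_0,\eta_0)$, $A_1=1/\eta_1$, $z_1=x_0-A_1\nabla f(w_1)$. For $k\ge1$: $a_k'=\frac{1+\sqrt{1+4\eta_kA_k}}{2\eta_k}$, $A_k'=A_k+a_k'$, $v_k=\frac{A_kw_k+a_k'z_k}{A_k'}$; $(y_k,\tau_k)=\mathrm{MSBacktrack}(v_k,\eta_k)$;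 $\gamma_k=\eta_k/\tau_k$, $a_{k+1}=\gamma_ka_k'$, $A_{k+1}=A_k+a_{k+1}$; $w_{k+1}=\frac{(1-\gamma_k)A_kw_k+\gamma_kA_k'y_k}{A_{k+1}}$, $z_{k+1}=z_k-a_{k+1}\nabla f(y_k)$; $\eta_{k+1}=\eta_k/2$ if $\tau_k=\eta_k$, and $\eta_{k+1}=2\eta_k$ otherwise. Initialization counts as one outer iteration, so $w_N$ is produced after $N$ outer iterations. Whenever a queried gradient is zero, the method returns the corresponding point, which is a minimizer, and all later outputs are understood to equal it (in particular if $\nabla f(x_0)=0$ it returns $x_0$ and all claims are trivial). If $\varepsilon_{\rm tr}=0$, then $K=+\infty$ is allowed and the second bound in (ii) is void. *)

theory Defs
  imports "HOL-Analysis.Analysis" "HOL-Library.Poly_Mapping"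
begin

section \<open>Euclidean space of arbitrary dimension inside one type\<close>

text \<open>
  The constants of the theorem are universal, in particular independent of the dimension, so the
  dimension has to be quantified inside the formula.  All spaces \<open>\<real>\<^sup>d\<close> are therefore realised as
  subspaces of the single inner product space of finitely supported real sequences.
\<close>

abbreviation lookup where "lookup \<equiv> Poly_Mapping.lookup"
abbreviation keys where "keys \<equiv> Poly_Mapping.keys"

instantiation poly_mapping :: (type, real_vector) real_vector
begin

lift_definition scaleR_poly_mapping :: "real \<Rightarrow> ('a \<Rightarrow>\<^sub>0 'b) \<Rightarrow> 'a \<Rightarrow>\<^sub>0 'b"
  is "\<lambda>c x i. c *\<^sub>R x i"
  by (erule rev_finite_subset) auto

instance
  by standard (transfer, simp add: fun_eq_iff algebra_simps)+

end

instantiation poly_mapping :: (type, real_inner) real_inner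
begin

definition inner_poly_mapping :: "('a \<Rightarrow>\<^sub>0 'b) \<Rightarrow> ('a \<Rightarrow>\<^sub>0 'b) \<Rightarrow> real" where
  "inner_poly_mapping x y = (\<Sum>i\<in>keys x \<union> keys y. lookup x i \<bullet> lookup y i)"

definition norm_poly_mapping :: "('a \<Rightarrow>\<^sub>0 'b) \<Rightarrow> real" where
  "norm_poly_mapping x = sqrt (x \<bullet> x)"

definition sgn_poly_mapping :: "('a \<Rightarrow>\<^sub>0 'b) \<Rightarrow> 'a \<Rightarrow>\<^sub>0 'b" where
  "sgn_poly_mapping x = x /\<^sub>R norm x"

definition dist_poly_mapping :: "('a \<Rightarrow>\<^sub>0 'b) \<Rightarrow> ('a \<Rightarrow>\<^sub>0 'b) \<Rightarrow> real" where
  "dist_poly_mapping x y = norm (x - y)"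

definition uniformity_poly_mapping :: "(('a \<Rightarrow>\<^sub>0 'b) \<times> ('a \<Rightarrow>\<^sub>0 'b)) filter" where
  "uniformity_poly_mapping = (INF e\<in>{0 <..}. principal {(x, y). dist x y < e})"

definition open_poly_mapping :: "('a \<Rightarrow>\<^sub>0 'b) set \<Rightarrow> bool" where
  "open_poly_mapping U \<longleftrightarrow> (\<forall>x\<in>U. eventually (\<lambda>(x', y). x' = x \<longrightarrow> y \<in> U) uniformity)"

lemma inner_poly_mapping_superset:
  fixes x y :: "'a \<Rightarrow>\<^sub>0 'b"
  assumes "finite S" "keys x \<subseteq> S \<or> keys y \<subseteq> S"
  shows "x \<bullet> y = (\<Sum>i\<in>S. lookup x i \<bullet> lookup y i)"
proof -
  have "x \<bullet> y = (\<Sum>i\<in>S \<union> (keys x \<union> keys y). lookup x i \<bullet> lookup y i)"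
    unfolding inner_poly_mapping_def using assms(1)
    by (intro sum.mono_neutral_left) (auto simp: in_keys_iff)
  also have "\<dots> = (\<Sum>i\<in>S. lookup x i \<bullet> lookup y i)"
  proof (rule sum.mono_neutral_right)
    have "lookup x i = 0 \<or> lookup y i = 0" if "i \<notin> S" for i
      using assms(2) that by (meson in_keys_iff subsetD)
    then show "\<forall>i\<in>S \<union> (keys x \<union> keys y) - S. lookup x i \<bullet> lookup y i = 0"
      by (metis DiffD2 inner_zero_left inner_zero_right)
  qed (use assms(1) in auto)
  finally show ?thesis .
qed

lemma lookup_scaleR: "lookup (c *\<^sub>R x) i = c *\<^sub>R lookup x i" for x :: "'a \<Rightarrow>\<^sub>0 'b"
  by transfer simp

instance
proof
  fix x y z :: "'a \<Rightarrow>\<^sub>0 'b" and r :: real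
  show "x \<bullet> y = y \<bullet> x"
    by (simp add: inner_poly_mapping_def inner_commute Un_commute)
  show "(x + y) \<bullet> z = x \<bullet> z + y \<bullet> z"
    by (simp add: inner_poly_mapping_superset[of "keys z"] lookup_add inner_add_left sum.distrib)
  show "(r *\<^sub>R x) \<bullet> y = r * (x \<bullet> y)"
    by (simp add: inner_poly_mapping_superset[of "keys y"] lookup_scaleR sum_distrib_left)
  show "0 \<le> x \<bullet> x"
    by (simp add: inner_poly_mapping_def sum_nonneg)
  show "x \<bullet> x = 0 \<longleftrightarrow> x = 0"
  proof
    assume "x \<bullet> x = 0"
    then have "\<forall>i\<in>keys x. lookup x i \<bullet> lookup x i = 0"
      by (simp add: inner_poly_mapping_def sum_nonneg_eq_0_iff)
    then show "x = 0"
      by (intro poly_mapping_eqI) (auto simp: in_keys_iff)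
  qed (simp add: inner_poly_mapping_def)
qed (simp_all add: norm_poly_mapping_def sgn_poly_mapping_def dist_poly_mapping_def
    uniformity_poly_mapping_def open_poly_mapping_def)

end

type_synonym rvec = "nat \<Rightarrow>\<^sub>0 real"

definition euclid :: "nat \<Rightarrow> rvec set" where
  "euclid d = {x. \<forall>i\<ge>d. lookup x i = 0}"

lemma keys_euclid: "x \<in> euclid d \<Longrightarrow> keys x \<subseteq> {..<d}"
  by (auto simp: euclid_def in_keys_iff) (meson linorder_not_less)

lemma inner_euclid: "x \<in> euclid d \<Longrightarrow> x \<bullet> y = (\<Sum>i<d. lookup x i * lookup y i)"
  using keys_euclid by (subst inner_poly_mapping_superset[of "{..<d}"]) auto

lemma norm_euclid: "x \<in> euclid d \<Longrightarrow> norm x = L2_set (lookup x) {..<d}"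
  by (simp add: norm_eq_sqrt_inner inner_euclid L2_set_def power2_eq_square)

lemma euclid_coords: "\<exists>!x. x \<in> euclid d \<and> (\<forall>i<d. lookup x i = c i)"
proof
  have "finite {i. (if i < d then c i else 0) \<noteq> 0}"
    by (rule finite_subset[of _ "{..<d}"]) auto
  then have "lookup (Abs_poly_mapping (\<lambda>i. if i < d then c i else 0)) =
      (\<lambda>i. if i < d then c i else 0)"
    by (intro lookup_Abs_poly_mapping) simp
  then show "Abs_poly_mapping (\<lambda>i. if i < d then c i else 0) \<in> euclid d \<and>
      (\<forall>i<d. lookup (Abs_poly_mapping (\<lambda>i. if i < d then c i else 0)) i = c i)"
    by (simp add: euclid_def)
next
  fix x assume "x \<in> euclid d \<and> (\<forall>i<d. lookup x i = c i)"
  then have "lookup x = (\<lambda>i. if i < d then c i else 0)"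
    by (auto simp: euclid_def fun_eq_iff)
  then show "x = Abs_poly_mapping (\<lambda>i. if i < d then c i else 0)"
    by (metis lookup_inverse)
qed

text \<open>
  A \<open>d \<times> d\<close> matrix is the operator on \<open>euclid d\<close>, extended by zero to the orthogonal complement.
  With this normalisation the operator norm of the ambient space is the operator norm on \<open>\<real>\<^sup>d\<close>
  (lemma \<open>norm_matrices_le_iff\<close>), and the matrix is determined by its action on \<open>\<real>\<^sup>d\<close>.
\<close>

definition matrices :: "nat \<Rightarrow> (rvec \<Rightarrow>\<^sub>L rvec) set" where
  "matrices d = {A. range (blinfun_apply A) \<subseteq> euclid d \<and>
     (\<forall>v. (\<forall>u\<in>euclid d. u \<bullet> v = 0) \<longrightarrow> blinfun_apply A v = 0)}"

lemma norm_matrices_le_iff: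
  assumes A: "A \<in> matrices d" and b: "0 \<le> b"
  shows "norm A \<le> b \<longleftrightarrow> (\<forall>v\<in>euclid d. norm (blinfun_apply A v) \<le> b * norm v)"
proof
  assume "norm A \<le> b"
  then show "\<forall>v\<in>euclid d. norm (blinfun_apply A v) \<le> b * norm v"
    by (meson mult_right_mono norm_blinfun norm_ge_zero order_trans)
next
  assume le: "\<forall>v\<in>euclid d. norm (blinfun_apply A v) \<le> b * norm v"
  show "norm A \<le> b"
  proof (rule norm_blinfun_bound[OF b])
    fix v
    obtain p where p: "p \<in> euclid d" "\<forall>i<d. lookup p i = lookup v i"
      using euclid_coords[of d "lookup v"] by blast
    have orth: "u \<bullet> (v - p) = 0" if "u \<in> euclid d" for u
      using p that by (simp add: inner_euclid[OF that] lookup_minus)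
    have "blinfun_apply A (v - p) = 0"
      using A orth by (simp add: matrices_def)
    then have "blinfun_apply A v = blinfun_apply A p"
      by (simp add: blinfun.diff_right)
    moreover have "norm p \<le> norm v"
    proof -
      have "v \<bullet> v = p \<bullet> p + (v - p) \<bullet> (v - p)"
        using orth[OF p(1)] by (simp add: inner_diff_right inner_diff_left inner_commute)
      then show ?thesis by (simp add: norm_eq_sqrt_inner)
    qed
    ultimately show "norm (blinfun_apply A v) \<le> b * norm v"
      using le p(1) b by (metis mult_left_mono order_trans)
  qed
qed

definition symmetric_mat :: "(rvec \<Rightarrow>\<^sub>L rvec) \<Rightarrow> bool" where
  "symmetric_mat A \<longleftrightarrow> (\<forall>u v. blinfun_apply A u \<bullet> v = u \<bullet> blinfun_apply A v)"


section \<open>The objective and its smoothness\<close>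

text \<open>Functions on \<open>\<real>\<^sup>d\<close> are total functions on \<^typ>\<open>rvec\<close>; only their values on \<open>euclid d\<close> matter.\<close>

definition twice_cont_diff ::
  "nat \<Rightarrow> (rvec \<Rightarrow> real) \<Rightarrow> (rvec \<Rightarrow> rvec) \<Rightarrow> (rvec \<Rightarrow> rvec \<Rightarrow>\<^sub>L rvec) \<Rightarrow> bool" where
  "twice_cont_diff d f grad hess \<longleftrightarrow>
     (\<forall>x\<in>euclid d. grad x \<in> euclid d \<and>
        (f has_derivative (\<lambda>h. grad x \<bullet> h)) (at x within euclid d)) \<and>
     (\<forall>x\<in>euclid d. hess x \<in> matrices d \<and>
        (grad has_derivative blinfun_apply (hess x)) (at x within euclid d)) \<and>
     continuous_on (euclid d) hess"

definition Lfun :: "real \<Rightarrow> real \<Rightarrow> (rvec \<Rightarrow> rvec) \<Rightarrow> rvec \<Rightarrow> real" where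
  "Lfun M0 M1 grad x = M0 + M1 * norm (grad x)"

text \<open>\<open>\<rho> = \<infinity>\<close> is the global condition, finite \<open>\<rho>\<close> the local one.\<close>

definition gen_hess_smooth ::
  "nat \<Rightarrow> (rvec \<Rightarrow> rvec) \<Rightarrow> (rvec \<Rightarrow> rvec \<Rightarrow>\<^sub>L rvec) \<Rightarrow> real \<Rightarrow> real \<Rightarrow> ereal \<Rightarrow> bool" where
  "gen_hess_smooth d grad hess M0 M1 \<rho> \<longleftrightarrow>
     (\<forall>x\<in>euclid d. \<forall>y\<in>euclid d. ereal (norm (y - x)) \<le> \<rho> \<longrightarrow>
        norm (hess y - hess x) \<le> Lfun M0 M1 grad x * norm (y - x))"


section \<open>The algorithm\<close>

definition regularized_step ::
  "nat \<Rightarrow> (rvec \<Rightarrow> rvec) \<Rightarrow> (rvec \<Rightarrow> rvec \<Rightarrow>\<^sub>L rvec) \<Rightarrow> rvec \<Rightarrow> real \<Rightarrow> rvec \<Rightarrow> bool" where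
  "regularized_step d grad H x \<tau> s \<longleftrightarrow>
     (\<forall>v\<in>euclid d. v \<noteq> 0 \<longrightarrow> (blinfun_apply (H x) v + \<tau> *\<^sub>R v) \<bullet> v > 0) \<and>
     s \<in> euclid d \<and> blinfun_apply (H x) s + \<tau> *\<^sub>R s = - grad x"

definition ms_test :: "(rvec \<Rightarrow> rvec) \<Rightarrow> rvec \<Rightarrow> real \<Rightarrow> rvec \<Rightarrow> bool" where
  "ms_test grad x \<tau> s \<longleftrightarrow> norm (grad (x + s) + \<tau> *\<^sub>R s) \<le> \<tau> / 2 * norm s"

text \<open>
  \<open>Zero_Grad p\<close>: a queried gradient vanished at \<open>p\<close>, and the whole method returns \<open>p\<close>.
  A backtracking loop that never accepts has no result.
\<close>

datatype backtrack_result = Zero_Grad rvec | Accepted rvec real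

inductive ms_backtrack ::
  "nat \<Rightarrow> (rvec \<Rightarrow> rvec) \<Rightarrow> (rvec \<Rightarrow> rvec \<Rightarrow>\<^sub>L rvec) \<Rightarrow> rvec \<Rightarrow> real \<Rightarrow> backtrack_result \<Rightarrow> bool"
  for d grad H x where
  zero_base: "grad x = 0 \<Longrightarrow> ms_backtrack d grad H x \<tau> (Zero_Grad x)"
| zero_trial: "grad x \<noteq> 0 \<Longrightarrow> regularized_step d grad H x \<tau> s \<Longrightarrow> grad (x + s) = 0 \<Longrightarrow>
    ms_backtrack d grad H x \<tau> (Zero_Grad (x + s))"
| accepted: "grad x \<noteq> 0 \<Longrightarrow> regularized_step d grad H x \<tau> s \<Longrightarrow> grad (x + s) \<noteq> 0 \<Longrightarrow>
    ms_test grad x \<tau> s \<Longrightarrow> ms_backtrack d grad H x \<tau> (Accepted (x + s) \<tau>)"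
| rejected: "grad x \<noteq> 0 \<Longrightarrow>
    (\<And>s. regularized_step d grad H x \<tau> s \<Longrightarrow> grad (x + s) \<noteq> 0 \<and> \<not> ms_test grad x \<tau> s) \<Longrightarrow>
    ms_backtrack d grad H x (2 * \<tau>) r \<Longrightarrow> ms_backtrack d grad H x \<tau> r"

text \<open>The state after \<open>k\<close> outer iterations: \<open>Running w\<^sub>k z\<^sub>k A\<^sub>k \<eta>\<^sub>k\<close>, or the point returned earlier.\<close>

datatype anpe_state = Running rvec rvec real real | Returned rvec

fun output_point :: "anpe_state \<Rightarrow> rvec" where
  "output_point (Running w z A \<eta>) = w"
| "output_point (Returned p) = p"

inductive anpe_init ::
  "nat \<Rightarrow> (rvec \<Rightarrow> rvec) \<Rightarrow> (rvec \<Rightarrow> rvec \<Rightarrow>\<^sub>L rvec) \<Rightarrow> rvec \<Rightarrow> real \<Rightarrow> anpe_state \<Rightarrow> bool"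
  for d grad H x0 \<eta>0 where
  "ms_backtrack d grad H x0 \<eta>0 (Zero_Grad p) \<Longrightarrow> anpe_init d grad H x0 \<eta>0 (Returned p)"
| "ms_backtrack d grad H x0 \<eta>0 (Accepted w \<eta>) \<Longrightarrow> A = 1 / \<eta> \<Longrightarrow>
    anpe_init d grad H x0 \<eta>0 (Running w (x0 - A *\<^sub>R grad w) A \<eta>)"

definition extra_weight :: "real \<Rightarrow> real \<Rightarrow> real" where
  "extra_weight A \<eta> = (1 + sqrt (1 + 4 * \<eta> * A)) / (2 * \<eta>)"

definition extrapolated :: "rvec \<Rightarrow> rvec \<Rightarrow> real \<Rightarrow> real \<Rightarrow> rvec" where
  "extrapolated w z A \<eta> =
     (A *\<^sub>R w + extra_weight A \<eta> *\<^sub>R z) /\<^sub>R (A + extra_weight A \<eta>)"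

inductive anpe_step ::
  "nat \<Rightarrow> (rvec \<Rightarrow> rvec) \<Rightarrow> (rvec \<Rightarrow> rvec \<Rightarrow>\<^sub>L rvec) \<Rightarrow> anpe_state \<Rightarrow> anpe_state \<Rightarrow> bool"
  for d grad H where
  "anpe_step d grad H (Returned p) (Returned p)"
| "ms_backtrack d grad H (extrapolated w z A \<eta>) \<eta> (Zero_Grad p) \<Longrightarrow>
    anpe_step d grad H (Running w z A \<eta>) (Returned p)"
| "ms_backtrack d grad H (extrapolated w z A \<eta>) \<eta> (Accepted y \<tau>) \<Longrightarrow>
    a' = extra_weight A \<eta> \<Longrightarrow>
    A' = A + a' \<Longrightarrow>
    \<gamma> = \<eta> / \<tau> \<Longrightarrow>
    a = \<gamma> * a' \<Longrightarrow>
    A_next = A + a \<Longrightarrow>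
    w_next = (((1 - \<gamma>) * A) *\<^sub>R w + (\<gamma> * A') *\<^sub>R y) /\<^sub>R A_next \<Longrightarrow>
    z_next = z - a *\<^sub>R grad y \<Longrightarrow>
    \<eta>_next = (if \<tau> = \<eta> then \<eta> / 2 else 2 * \<eta>) \<Longrightarrow>
    anpe_step d grad H (Running w z A \<eta>) (Running w_next z_next A_next \<eta>_next)"

text \<open>\<open>w k\<close> is the output after \<open>k \<ge> 1\<close> outer iterations; \<open>w 0\<close> is irrelevant.\<close>

definition anpe_outputs ::
  "nat \<Rightarrow> (rvec \<Rightarrow> rvec) \<Rightarrow> (rvec \<Rightarrow> rvec \<Rightarrow>\<^sub>L rvec) \<Rightarrow> rvec \<Rightarrow> real \<Rightarrow> (nat \<Rightarrow> rvec) \<Rightarrow> bool" where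
  "anpe_outputs d grad H x0 \<eta>0 w \<longleftrightarrow>
     (\<exists>X. anpe_init d grad H x0 \<eta>0 (X 1) \<and>
          (\<forall>k\<ge>1. anpe_step d grad H (X k) (X (Suc k))) \<and>
          (\<forall>k\<ge>1. w k = output_point (X k)))"


section \<open>Quantities in the bounds\<close>

definition log_plus :: "real \<Rightarrow> real" where
  "log_plus t = (if t \<le> 0 then 0 else max 0 (ln t))"

text \<open>The division \<open>r / \<rho>\<close> is taken in \<^typ>\<open>ereal\<close>, so it is \<open>0\<close> for \<open>\<rho> = \<infinity>\<close>.\<close>

definition over_radius :: "real \<Rightarrow> ereal \<Rightarrow> real" where
  "over_radius r \<rho> = real_of_ereal (ereal r / \<rho>)"

definition B_const :: "real \<Rightarrow> ereal \<Rightarrow> real \<Rightarrow> real" where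
  "B_const M1 \<rho> R =
     Max {1, (6 * sqrt M1 * R) powr (2/3), over_radius (2 * R) \<rho> powr (2/3)}"

definition eps_tr :: "real \<Rightarrow> real \<Rightarrow> real \<Rightarrow> real \<Rightarrow> real" where
  "eps_tr M0 \<delta> R B = max (48 * M0 * R^3 / B powr (7/2)) (16 * \<delta> * R^2 / B^2)"

definition tau_bar ::
  "real \<Rightarrow> real \<Rightarrow> real \<Rightarrow> ereal \<Rightarrow> (rvec \<Rightarrow> rvec) \<Rightarrow> rvec \<Rightarrow> real" where
  "tau_bar M0 M1 \<delta> \<rho> grad x0 =
     Max {4 * \<delta>, 2 * sqrt (Lfun M0 M1 grad x0 * norm (grad x0)),
          over_radius (2 * norm (grad x0)) \<rho>}"

end

theory Submission
  imports Defs
begin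

text \<open>
  Write \<open>E\<^sub>k = A\<^sub>k (f w\<^sub>k - f xs) + \<bar>z\<^sub>k - xs\<bar>\<^sup>2 / 2\<close>.  An accepted trial step \<open>s\<close> is an approximate
  proximal step, and the momentum damping \<open>\<gamma> = \<eta> / \<tau>\<close> is chosen so that the usual accelerated
  proximal argument still closes when \<open>\<tau>\<close> exceeds the predicted \<open>\<eta>\<close>: the energy drops by at least
  \<open>3/8 \<eta> A' \<bar>s\<bar>\<^sup>2\<close> (\<open>monteiro_svaiter_energy_decrease\<close>).  Hence \<open>f w\<^sub>k - f xs \<le> R\<^sup>2 / (2 A\<^sub>k)\<close>, and only the
  growth of the weights \<open>A\<^sub>k\<close> remains to be understood.

  An undamped step with parameter \<open>\<eta>\<close> increases \<open>sqrt A\<close> by at least \<open>1 / (2 sqrt \<eta>)\<close>, so slow growth can only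
  come from a large \<open>\<eta>\<close>.  But \<open>\<eta>\<close> is only raised after a rejected trial, and rejections are expensive.
  Comparing all Hessians with the one at the \<^emph>\<open>end\<close> of the rejected trial, where the gradient
  is controlled by the trial itself (unlike at its base point), shows that a rejected trial \<open>s\<close> at
  level \<open>\<tau>\<close> has \<open>\<tau> = O(\<delta>)\<close>, or \<open>\<tau> = O(M0 \<bar>s\<bar>)\<close>, or \<open>M1 \<bar>s\<bar>\<^sup>2\<close> bounded below, or leaves the radius \<open>\<rho>\<close>
  (\<open>rejected_trial\<close>).  The last two mean \<open>R\<^sup>2 = O(B\<^sup>3 \<bar>s\<bar>\<^sup>2)\<close> by the choice of \<open>B\<close>, so raising \<open>\<eta>\<close> above
  order \<open>\<delta>\<close> costs energy of order \<open>\<eta> A R\<^sup>2 / B\<^sup>3\<close> or \<open>\<eta>\<^sup>3 A / M0\<^sup>2\<close>, out of a budget of \<open>R\<^sup>2 / 2\<close>.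

  Balancing these costs against the growth gives the central estimate (\<open>length_bound\<close>): for \<open>P \<ge> B\<close>, as
  long as \<open>M0 R A\<^sub>T \<le> P\<^bsup>7/2\<^esup>\<close> and \<open>\<delta> A\<^sub>T \<le> P\<^sup>2\<close>, the index satisfies \<open>T = O(P + B ln (A\<^sub>T / A\<^sub>1))\<close>.
  It is proved with a potential whose increments are at least one for every success and nonnegative
  for every failure; failures are counted through \<open>log 2 \<eta>\<close>, which moves by \<open>-1\<close> at a success and by
  \<open>+1\<close> at a failure.

  In terms of a target accuracy \<open>\<epsilon>\<close> this becomes \<open>accuracy_iteration_bound\<close>, and the three
  claims are three choices of \<open>P\<close>: the sum \<open>B + (M0 R\<^sup>3 / \<epsilon>)\<^bsup>2/7\<^esup> + sqrt (\<delta> R\<^sup>2 / \<epsilon>)\<close> for the iteration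
  count, \<open>B\<close> itself for the linear phase, and \<open>B\<close> plus a small multiple of \<open>n\<close> for the
  sublinear phase.
\<close>

section \<open>Calculus of a convex function on a subspace\<close>

text \<open>
  The image of a basis \<open>Q\<close> of \<open>S\<close> is independent; a point of \<open>S\<close> outside the image of \<open>L\<close> could be added to
  it, giving an independent set in \<open>span Q\<close> with more elements than \<open>Q\<close>.
\<close>

lemma linear_injective_on_imp_surjective_on:
  fixes L :: "'a::real_vector \<Rightarrow> 'a"
  assumes L: "linear L" and S: "subspace S" "S \<subseteq> span F" "finite F"
    and closed: "\<And>v. v \<in> S \<Longrightarrow> L v \<in> S"
    and inj: "\<And>v. v \<in> S \<Longrightarrow> L v = 0 \<Longrightarrow> v = 0" and y: "y \<in> S"
  shows "\<exists>s\<in>S. L s = y"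
proof (rule ccontr)
  assume no: "\<not> (\<exists>s\<in>S. L s = y)"
  obtain Q where Q: "Q \<subseteq> S" "independent Q" "S \<subseteq> span Q"
    using maximal_independent_subset[of S] by blast
  have spanQ: "span Q = S"
    using Q S(1) by (simp add: span_minimal subset_antisym)
  have finQ: "finite Q"
    using independent_span_bound[OF S(3) Q(2)] Q(1) S(2) by auto
  have injS: "inj_on L (span Q)"
    unfolding spanQ
  proof (rule inj_onI)
    fix u v assume "u \<in> S" "v \<in> S" "L u = L v"
    then show "u = v"
      using inj[of "u - v"] S(1) by (simp add: linear_diff[OF L] subspace_diff)
  qed
  have ind: "independent (L ` Q)"
    using linear_independent_injective_image[OF L Q(2) injS] .
  have "span (L ` Q) = L ` S"
    using linear_span_image[OF L, of Q] spanQ by simp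
  with no have "y \<notin> span (L ` Q)"
    by auto
  then have ind_insert: "independent (insert y (L ` Q))"
    using ind by (rule independent_insertI)
  have "insert y (L ` Q) \<subseteq> span Q"
    using y closed Q(1) spanQ by auto
  from independent_span_bound[OF finQ ind_insert this]
  have "card (insert y (L ` Q)) \<le> card Q"
    by (rule conjunct2)
  moreover have "card (insert y (L ` Q)) = Suc (card Q)"
  proof -
    have "y \<notin> L ` Q"
      using \<open>y \<notin> span (L ` Q)\<close> by (auto intro: span_base)
    moreover have "card (L ` Q) = card Q"
      by (rule card_image) (rule inj_on_subset[OF injS span_superset])
    ultimately show ?thesis
      using finQ by simp
  qed
  ultimately show False by simp
qed

lemma subspace_euclid: "subspace (euclid d)"
  by (auto simp: subspace_def euclid_def lookup_add lookup_scaleR)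

lemma euclid_subset_span:
  "euclid d \<subseteq> span ((\<lambda>i. Poly_Mapping.single i (1::real)) ` {..<d})"
proof
  fix x assume x: "x \<in> euclid d"
  have "x = (\<Sum>i<d. lookup x i *\<^sub>R Poly_Mapping.single i (1::real))"
  proof (rule poly_mapping_eqI)
    fix k
    have "lookup (\<Sum>i<d. lookup x i *\<^sub>R Poly_Mapping.single i (1::real)) k
        = (\<Sum>i<d. if i = k then lookup x i else 0)"
      unfolding lookup_sum by (rule sum.cong) (auto simp: lookup_scaleR lookup_single when_def)
    also have "\<dots> = lookup x k"
      using x by (auto simp: euclid_def)
    finally show "lookup x k = lookup (\<Sum>i<d. lookup x i *\<^sub>R Poly_Mapping.single i (1::real)) k"
      by simp
  qed
  moreover have "(\<Sum>i<d. lookup x i *\<^sub>R Poly_Mapping.single i (1::real))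
      \<in> span ((\<lambda>i. Poly_Mapping.single i (1::real)) ` {..<d})"
    by (intro span_sum span_scale span_base) simp
  ultimately show "x \<in> span ((\<lambda>i. Poly_Mapping.single i (1::real)) ` {..<d})"
    by simp
qed

locale convex_smooth_problem =
  fixes d :: nat and f :: "rvec \<Rightarrow> real" and grad :: "rvec \<Rightarrow> rvec"
    and hess H :: "rvec \<Rightarrow> rvec \<Rightarrow>\<^sub>L rvec" and M0 M1 :: real and \<rho> :: ereal
    and \<delta> :: real and xs :: rvec
  assumes convex_f: "convex_on (euclid d) f"
    and twice_diff: "twice_cont_diff d f grad hess"
    and minimizer: "xs \<in> euclid d" "\<And>x. x \<in> euclid d \<Longrightarrow> f xs \<le> f x"
    and approx: "\<And>x. x \<in> euclid d \<Longrightarrow>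
      H x \<in> matrices d \<and> symmetric_mat (H x) \<and> norm (H x - hess x) \<le> \<delta>"
    and M0_nonneg: "0 \<le> M0" and M1_nonneg: "0 \<le> M1" and \<rho>_pos: "0 < \<rho>"
    and hess_smooth: "gen_hess_smooth d grad hess M0 M1 \<rho>"
begin

lemmas in_euclid_intros = subspace_add[OF subspace_euclid] subspace_diff[OF subspace_euclid]
  subspace_scale[OF subspace_euclid] subspace_neg[OF subspace_euclid] minimizer(1)

lemma \<delta>_nonneg: "0 \<le> \<delta>"
  using approx[OF minimizer(1)] norm_ge_zero order_trans by blast

lemma grad_in: "x \<in> euclid d \<Longrightarrow> grad x \<in> euclid d"
  using twice_diff by (simp add: twice_cont_diff_def)

lemma H_in: "x \<in> euclid d \<Longrightarrow> H x v \<in> euclid d"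
  using approx by (force simp: matrices_def)

lemma line_in: "x \<in> euclid d \<Longrightarrow> v \<in> euclid d \<Longrightarrow> x + t *\<^sub>R v \<in> euclid d"
  by (intro in_euclid_intros)

text \<open>
  Derivatives are only given within \<open>euclid d\<close>; restricted to a line in that subspace they become
  ordinary derivatives of functions on the reals, to which one-dimensional calculus applies.
\<close>

lemma has_derivative_along_line:
  assumes "x \<in> euclid d" "v \<in> euclid d" and F: "(F has_derivative F') (at x within euclid d)"
  shows "((\<lambda>t. F (x + t *\<^sub>R v)) has_derivative (\<lambda>t. F' (t *\<^sub>R v))) (at 0)"
proof -
  have "((\<lambda>t. x + t *\<^sub>R v) has_derivative (\<lambda>t. t *\<^sub>R v)) (at (0::real))"
    by (auto intro!: derivative_eq_intros)
  moreover have "(F has_derivative F') (at (x + 0 *\<^sub>R v) within range (\<lambda>t::real. x + t *\<^sub>R v))"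
    using has_derivative_subset[OF F, of "range (\<lambda>t::real. x + t *\<^sub>R v)"] line_in[OF assms(1,2)]
    by auto
  ultimately show ?thesis
    by (rule has_derivative_in_compose)
qed

lemma f_deriv_along_line:
  assumes "x \<in> euclid d" "v \<in> euclid d"
  shows "((\<lambda>t. f (x + t *\<^sub>R v)) has_real_derivative grad x \<bullet> v) (at 0)"
proof -
  have "(f has_derivative (\<lambda>h. grad x \<bullet> h)) (at x within euclid d)"
    using twice_diff assms(1) by (simp add: twice_cont_diff_def)
  from has_derivative_along_line[OF assms this] show ?thesis
    by (simp add: has_field_derivative_def mult.commute mult_commute_abs)
qed

lemma convexity_above_tangent:
  assumes x: "x \<in> euclid d" and u: "u \<in> euclid d"
  shows "f x + grad x \<bullet> (u - x) \<le> f u"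
proof -
  let ?v = "u - x"
  let ?g = "\<lambda>t. f (x + t *\<^sub>R ?v)"
  have v: "?v \<in> euclid d" using x u by (intro in_euclid_intros)
  have conv: "convex_on UNIV ?g"
  proof (rule convex_onI)
    fix t a b :: real assume t: "0 < t" "t < 1"
    have "x + ((1 - t) *\<^sub>R a + t *\<^sub>R b) *\<^sub>R ?v
        = (1 - t) *\<^sub>R (x + a *\<^sub>R ?v) + t *\<^sub>R (x + b *\<^sub>R ?v)"
      by (simp add: algebra_simps)
    then show "?g ((1 - t) *\<^sub>R a + t *\<^sub>R b) \<le> (1 - t) * ?g a + t * ?g b"
      using convex_onD[OF convex_f, of t "x + a *\<^sub>R ?v" "x + b *\<^sub>R ?v"] t line_in[OF x v] by simp
  qed simp
  have "?g 1 - ?g 0 \<ge> (grad x \<bullet> ?v) * (1 - 0)"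
    by (rule convex_on_imp_above_tangent[OF conv]) (use f_deriv_along_line[OF x v] in auto)
  then show ?thesis by simp
qed

lemma grad_zero_imp_min:
  assumes "x \<in> euclid d" "grad x = 0" shows "f x = f xs"
  using convexity_above_tangent[OF assms(1) minimizer(1)] minimizer assms by force

lemma grad_minimizer: "grad xs = 0"
proof -
  have g: "grad xs \<in> euclid d" by (intro grad_in minimizer)
  have "grad xs \<bullet> grad xs = 0"
    using DERIV_local_min[OF f_deriv_along_line[OF minimizer(1) g], of 1]
      minimizer(2)[OF line_in[OF minimizer(1) g]] by simp
  then show ?thesis by simp
qed

text \<open>
  Adding the tangent inequalities at two points shows that \<open>t \<mapsto> grad (x + t v) \<bullet> v\<close> is nondecreasing;
  its slope at 0 is the quadratic form of the Hessian.
\<close>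

lemma hess_psd:
  assumes x: "x \<in> euclid d" and v: "v \<in> euclid d"
  shows "0 \<le> hess x v \<bullet> v"
proof -
  let ?g = "\<lambda>t. grad (x + t *\<^sub>R v) \<bullet> v"
  have "(grad has_derivative hess x) (at x within euclid d)"
    using twice_diff x by (simp add: twice_cont_diff_def)
  from has_derivative_inner_left[OF has_derivative_along_line[OF x v this], of v]
  have deriv: "(?g has_real_derivative hess x v \<bullet> v) (at 0)"
    by (simp add: has_field_derivative_def blinfun.scaleR_right mult.commute mult_commute_abs)
  have "mono_on UNIV ?g"
  proof (rule mono_onI)
    fix a b :: real assume ab: "a \<le> b"
    let ?a = "x + a *\<^sub>R v" and ?b = "x + b *\<^sub>R v"
    have "?a \<in> euclid d" "?b \<in> euclid d" using line_in[OF x v] by auto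
    from convexity_above_tangent[OF this] convexity_above_tangent[OF this(2,1)]
    have "0 \<le> (b - a) * (?g b - ?g a)"
      by (simp add: algebra_simps inner_diff_right)
    then show "?g a \<le> ?g b"
      using ab by (cases "a = b") (auto simp: zero_le_mult_iff)
  qed
  then show ?thesis
    using mono_on_imp_deriv_nonneg deriv by fastforce
qed

lemma H_lower:
  assumes x: "x \<in> euclid d" and v: "v \<in> euclid d"
  shows "- \<delta> * (norm v)\<^sup>2 \<le> H x v \<bullet> v"
proof -
  have "\<bar>(H x - hess x) v \<bullet> v\<bar> \<le> norm ((H x - hess x) v) * norm v"
    by (rule Cauchy_Schwarz_ineq2)
  also have "\<dots> \<le> (\<delta> * norm v) * norm v"
    using approx[OF x] norm_blinfun[of "H x - hess x" v]
    by (intro mult_right_mono) (meson mult_right_mono norm_ge_zero order_trans, simp)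
  finally show ?thesis
    using hess_psd[OF x v] by (simp add: blinfun.diff_left inner_diff_left power2_eq_square)
qed

text \<open>
  The comparison operator \<open>G\<close> is arbitrary, so that the gradient difference can be expanded around the
  Hessian at either end of the segment.
\<close>

lemma gradient_linearization:
  assumes x: "x \<in> euclid d" and y: "y \<in> euclid d"
    and G: "\<And>u. u \<in> closed_segment x y \<Longrightarrow> norm (hess u - G) \<le> K"
  shows "norm (grad y - grad x - blinfun_apply G (y - x)) \<le> K * norm (y - x)"
proof -
  have sub: "closed_segment x y \<subseteq> euclid d"
    using x y subspace_imp_convex[OF subspace_euclid] by (simp add: closed_segment_subset)
  have "norm ((grad y - G y) - (grad x - G x)) \<le> K * norm (y - x)"
  proof (rule differentiable_bound[of "closed_segment x y" "\<lambda>u. grad u - G u" "\<lambda>u h. hess u h - G h"])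
    fix u assume u: "u \<in> closed_segment x y"
    then have "(grad has_derivative hess u) (at u within euclid d)"
      using twice_diff sub by (auto simp: twice_cont_diff_def)
    then show "((\<lambda>u. grad u - G u) has_derivative (\<lambda>h. hess u h - G h)) (at u within closed_segment x y)"
      using sub by (intro has_derivative_diff bounded_linear_imp_has_derivative
          blinfun.bounded_linear_right) (rule has_derivative_subset)
    have "onorm (\<lambda>h. hess u h - G h) = norm (hess u - G)"
      by (simp add: norm_blinfun.rep_eq minus_blinfun.rep_eq)
    then show "onorm (\<lambda>h. hess u h - G h) \<le> K"
      using G[OF u] by simp
  qed auto
  then show ?thesis
    by (simp add: blinfun.diff_right algebra_simps)
qed

end

section \<open>Trial steps\<close>

context convex_smooth_problem begin

abbreviation L :: "rvec \<Rightarrow> real" where "L \<equiv> Lfun M0 M1 grad"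

abbreviation step_at :: "rvec \<Rightarrow> real \<Rightarrow> rvec \<Rightarrow> bool" where
  "step_at \<equiv> regularized_step d grad H"

lemma L_nonneg: "0 \<le> L x"
  using M0_nonneg M1_nonneg by (simp add: Lfun_def)

lemma step_in: "step_at x \<tau> s \<Longrightarrow> s \<in> euclid d"
  by (simp add: regularized_step_def)

lemma trial_in: "x \<in> euclid d \<Longrightarrow> step_at x \<tau> s \<Longrightarrow> x + s \<in> euclid d"
  by (rule subspace_add[OF subspace_euclid _ step_in])

lemma step_eq: "step_at x \<tau> s \<Longrightarrow> H x s + \<tau> *\<^sub>R s = - grad x"
  by (simp add: regularized_step_def)

lemma regularized_inner_lower:
  assumes "x \<in> euclid d" "v \<in> euclid d"
  shows "(\<tau> - \<delta>) * (norm v)\<^sup>2 \<le> (H x v + \<tau> *\<^sub>R v) \<bullet> v"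
  using H_lower[OF assms] by (simp add: inner_add_left power2_norm_eq_inner algebra_simps)

lemma regularized_norm_lower:
  assumes "x \<in> euclid d" "v \<in> euclid d"
  shows "(\<tau> - \<delta>) * norm v \<le> norm (H x v + \<tau> *\<^sub>R v)"
proof (cases "v = 0")
  case False
  have "(\<tau> - \<delta>) * norm v * norm v \<le> norm (H x v + \<tau> *\<^sub>R v) * norm v"
    using regularized_inner_lower[OF assms, of \<tau>] norm_cauchy_schwarz[of "H x v + \<tau> *\<^sub>R v" v]
    by (simp add: power2_eq_square mult.assoc)
  then show ?thesis using False by simp
qed simp

lemma regularized_step_exists:
  assumes x: "x \<in> euclid d" and \<tau>: "\<delta> < \<tau>"
  obtains s where "step_at x \<tau> s"
proof -
  have pd: "0 < (H x v + \<tau> *\<^sub>R v) \<bullet> v" if "v \<in> euclid d" "v \<noteq> 0" for v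
    using regularized_inner_lower[OF x that(1), of \<tau>] \<tau> that(2)
    by (smt (verit) mult_pos_pos zero_less_norm_iff zero_less_power)
  have "\<exists>s\<in>euclid d. H x s + \<tau> *\<^sub>R s = - grad x"
  proof (rule linear_injective_on_imp_surjective_on[OF _ subspace_euclid euclid_subset_span])
    show "linear (\<lambda>v. H x v + \<tau> *\<^sub>R v)"
      by (rule linearI) (auto simp: blinfun.add_right blinfun.scaleR_right algebra_simps)
    show "v = 0" if "v \<in> euclid d" "H x v + \<tau> *\<^sub>R v = 0" for v
      using pd[OF that(1)] that(2) by force
  qed (use x H_in grad_in in \<open>auto intro!: in_euclid_intros\<close>)
  then show ?thesis
    using that pd by (auto simp: regularized_step_def)
qed

lemma step_norm_le:
  assumes "x \<in> euclid d" "step_at x \<tau> s"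
  shows "(\<tau> - \<delta>) * norm s \<le> norm (grad x)"
  using regularized_norm_lower[OF assms(1) step_in[OF assms(2)], of \<tau>] step_eq[OF assms(2)] by simp

text \<open>
  The residual of a trial is the error made in replacing the gradient difference by \<open>H x s\<close>.  It can be
  measured with the smoothness constant at either end \<open>c\<close> of the trial: the base point is used to
  show that large \<open>\<tau>\<close> are accepted, the end point to analyse rejections.
\<close>

lemma trial_residual_le:
  assumes x: "x \<in> euclid d" and s: "step_at x \<tau> s" and c: "c = x \<or> c = x + s"
    and r: "ereal (norm s) \<le> \<rho>"
  shows "norm (grad (x + s) + \<tau> *\<^sub>R s) \<le> \<delta> * norm s + 2 * L c * (norm s)\<^sup>2"
proof -
  note sE = step_in[OF s]
  have xs: "x + s \<in> euclid d" by (rule trial_in[OF x s])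
  then have cE: "c \<in> euclid d" using x c by auto
  have seg: "closed_segment x (x + s) \<subseteq> euclid d"
    using x xs subspace_imp_convex[OF subspace_euclid] by (simp add: closed_segment_subset)
  have near: "norm (hess u - hess c) \<le> L c * norm s" if u: "u \<in> closed_segment x (x + s)" for u
  proof -
    have "norm (u - c) \<le> norm s"
      using c segment_bound[OF u] by auto
    then have "norm (hess u - hess c) \<le> L c * norm (u - c)"
      using hess_smooth cE u seg r unfolding gen_hess_smooth_def
      by (metis ereal_less_eq(3) order_trans subsetD)
    also have "\<dots> \<le> L c * norm s"
      using \<open>norm (u - c) \<le> norm s\<close> L_nonneg by (rule mult_left_mono)
    finally show ?thesis .
  qed
  have 1: "norm (grad (x + s) - grad x - hess c s) \<le> L c * norm s * norm s"
    using gradient_linearization[OF x xs near] by simp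
  have 2: "norm ((hess x - hess c) s) \<le> L c * norm s * norm s"
    using near[of x] norm_blinfun[of "hess x - hess c" s]
    by (meson ends_in_segment(1) mult_right_mono norm_ge_zero order_trans)
  have 3: "norm ((H x - hess x) s) \<le> \<delta> * norm s"
    using approx[OF x] norm_blinfun[of "H x - hess x" s]
    by (meson mult_right_mono norm_ge_zero order_trans)
  have eq: "grad (x + s) + \<tau> *\<^sub>R s = (grad (x + s) - grad x - hess c s)
      - (hess x - hess c) s - (H x - hess x) s"
    using step_eq[OF s] by (simp add: blinfun.diff_left algebra_simps)
  have "norm (grad (x + s) + \<tau> *\<^sub>R s) \<le> norm (grad (x + s) - grad x - hess c s)
      + norm ((hess x - hess c) s) + norm ((H x - hess x) s)"
    unfolding eq
    using norm_triangle_ineq4[of "grad (x + s) - grad x - hess c s" "(hess x - hess c) s"]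
      norm_triangle_ineq4[of "grad (x + s) - grad x - hess c s - (hess x - hess c) s"
        "(H x - hess x) s"] by linarith
  with 1 2 3 show ?thesis
    by (simp add: power2_eq_square mult.assoc)
qed

text \<open>
  Rejection makes the residual \<open>E\<close> exceed \<open>\<tau> \<bar>s\<bar> / 2\<close>, so the gradient at the end point is at most \<open>3 E\<close>.
  Bounding \<open>E\<close> with the smoothness constant there gives
  \<open>E \<le> \<delta> \<bar>s\<bar> + 2 M0 \<bar>s\<bar>\<^sup>2 + 6 M1 \<bar>s\<bar>\<^sup>2 E\<close>, and for short steps the last term is absorbed on the left.
\<close>

lemma rejected_trial:
  assumes x: "x \<in> euclid d" and s: "step_at x \<tau> s" and \<tau>: "0 < \<tau>" "4 * \<delta> \<le> \<tau>"
    and rej: "\<not> ms_test grad x \<tau> s"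
  shows "\<rho> < ereal (norm s) \<or> 1 < 24 * M1 * (norm s)\<^sup>2 \<or> \<tau> < 16 * M0 * norm s"
proof (rule ccontr)
  assume neg: "\<not> ?thesis"
  let ?n = "norm s" and ?E = "norm (grad (x + s) + \<tau> *\<^sub>R s)"
  have E: "\<tau> / 2 * ?n < ?E" using rej by (simp add: ms_test_def)
  have n: "0 < ?n" 
  proof (rule ccontr)
    assume "\<not> 0 < ?n"
    then have "s = 0" by simp
    with step_eq[OF s] rej show False by (simp add: ms_test_def)
  qed
  have g: "norm (grad (x + s)) \<le> 3 * ?E"
  proof -
    have "norm (grad (x + s)) \<le> ?E + norm (\<tau> *\<^sub>R s)"
      using norm_triangle_ineq4[of "grad (x + s) + \<tau> *\<^sub>R s" "\<tau> *\<^sub>R s"] by simp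
    then show ?thesis using E \<tau> by simp
  qed
  have "?E \<le> \<delta> * ?n + 2 * L (x + s) * ?n\<^sup>2"
    using trial_residual_le[OF x s, of "x + s"] neg by auto
  also have "\<dots> \<le> \<delta> * ?n + 2 * (M0 + M1 * (3 * ?E)) * ?n\<^sup>2"
    unfolding Lfun_def using g M1_nonneg
    by (intro add_left_mono mult_right_mono mult_left_mono) auto
  also have "\<dots> = \<delta> * ?n + 2 * M0 * ?n * ?n + (24 * M1 * ?n\<^sup>2) * (?E / 4)"
    by (simp add: power2_eq_square algebra_simps)
  also have "\<dots> \<le> \<delta> * ?n + 2 * M0 * ?n * ?n + 1 * (?E / 4)"
    using neg by (intro add_left_mono mult_right_mono) auto
  finally have "3 / 4 * ?E \<le> (\<delta> + 2 * M0 * ?n) * ?n" by (simp add: algebra_simps)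
  moreover have "3 / 8 * \<tau> * ?n < 3 / 4 * ?E" using E by simp
  ultimately have "3 / 8 * \<tau> * ?n < (\<delta> + 2 * M0 * ?n) * ?n" by linarith
  then have "3 / 8 * \<tau> < \<delta> + 2 * M0 * ?n" using n by simp
  then show False using neg \<tau> by auto
qed

text \<open>
  For \<open>\<tau> \<ge> 8 \<delta>\<close> the length of the step is at most \<open>8 \<bar>grad x\<bar> / (7 \<tau>)\<close>, so the remaining terms of \<open>tau_bar\<close> keep it
  within the radius and make the quadratic part of the residual small.
\<close>

lemma large_\<tau>_accepted:
  assumes x: "x \<in> euclid d" and s: "step_at x \<tau> s" and \<tau>: "0 < \<tau>"
    and large: "2 * tau_bar M0 M1 \<delta> \<rho> grad x \<le> \<tau>"
  shows "ms_test grad x \<tau> s"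
proof -
  let ?g = "norm (grad x)" and ?n = "norm s"
  have l1: "8 * \<delta> \<le> \<tau>" and l2: "4 * sqrt (L x * ?g) \<le> \<tau>" and l3: "2 * over_radius (2 * ?g) \<rho> \<le> \<tau>"
    using large by (auto simp: tau_bar_def)
  have n: "7 / 8 * \<tau> * ?n \<le> ?g"
  proof -
    have "7 / 8 * \<tau> * ?n \<le> (\<tau> - \<delta>) * ?n" using l1 by (intro mult_right_mono) auto
    then show ?thesis using step_norm_le[OF x s] by linarith
  qed
  have r: "ereal ?n \<le> \<rho>"
  proof (cases \<rho>)
    case (real r)
    have rpos: "0 < r" using \<rho>_pos real by simp
    have "4 * ?g \<le> \<tau> * r"
      using l3 rpos real by (simp add: over_radius_def field_simps)
    moreover have "0 \<le> \<tau> * ?n" using \<tau> by simp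
    ultimately have "\<tau> * ?n \<le> \<tau> * r" using n by linarith
    then show ?thesis using \<tau> real by simp
  qed (use \<rho>_pos in auto)
  have L: "16 * (L x * ?g) \<le> \<tau>\<^sup>2"
  proof -
    have "(4 * sqrt (L x * ?g))\<^sup>2 \<le> \<tau>\<^sup>2"
      using l2 L_nonneg by (intro power_mono) auto
    then show ?thesis using L_nonneg by (simp add: power_mult_distrib)
  qed
  have "L x * (7 / 8 * \<tau> * ?n) \<le> L x * ?g"
    using n L_nonneg by (rule mult_left_mono)
  with L have "14 * (L x * ?n) * \<tau> \<le> \<tau> * \<tau>" by (simp add: power2_eq_square mult_ac)
  then have "14 * (L x * ?n) \<le> \<tau>" using \<tau> by simp
  then have "(\<delta> + 2 * (L x * ?n)) * ?n \<le> \<tau> / 2 * ?n"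
    using l1 \<tau> by (intro mult_right_mono) auto
  then show ?thesis
    using trial_residual_le[OF x s _ r, of x]
    by (simp add: ms_test_def power2_eq_square algebra_simps)
qed

abbreviation backtrack where "backtrack \<equiv> ms_backtrack d grad H"

text \<open>
  Doubling eventually exceeds \<open>2 tau_bar\<close>, where the trial step exists and passes the test.
\<close>

lemma backtrack_terminates:
  assumes x: "x \<in> euclid d" and \<tau>: "0 < \<tau>"
  shows "\<exists>r. backtrack x \<tau> r"
proof (cases "grad x = 0")
  case True
  then show ?thesis using zero_base by blast
next
  case nz: False
  obtain n where n: "2 * tau_bar M0 M1 \<delta> \<rho> grad x / \<tau> < 2 ^ n"
    using real_arch_pow[of 2] by auto
  have "2 * tau_bar M0 M1 \<delta> \<rho> grad x \<le> 2 ^ n * \<tau>"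
    using n \<tau> by (simp add: field_simps)
  then show ?thesis
    using \<tau>
  proof (induction n arbitrary: \<tau>)
    case 0
    then have "4 * \<delta> \<le> \<tau> / 2"
      by (simp add: tau_bar_def)
    then have "\<delta> < \<tau>" using 0 by linarith
    then obtain s where s: "step_at x \<tau> s"
      using regularized_step_exists[OF x] by blast
    have "ms_test grad x \<tau> s" using large_\<tau>_accepted[OF x s] 0 by simp
    then show ?case
      using s nz accepted zero_trial by (cases "grad (x + s) = 0") blast+
  next
    case (Suc n)
    obtain r where r: "backtrack x (2 * \<tau>) r"
      using Suc.IH[of "2 * \<tau>"] Suc.prems by (auto simp: mult_ac)
    show ?case
    proof (cases "\<exists>s. step_at x \<tau> s \<and> (grad (x + s) = 0 \<or> ms_test grad x \<tau> s)")
      case True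
      then show ?thesis using nz accepted zero_trial by blast
    next
      case False
      then show ?thesis using rejected[OF nz _ r] by blast
    qed
  qed
qed

lemma backtrack_zero:
  assumes "backtrack x \<tau> r" "x \<in> euclid d" "r = Zero_Grad p"
  shows "p \<in> euclid d \<and> grad p = 0"
  using assms by (induction rule: ms_backtrack.induct) (auto intro: trial_in)

text \<open>
  Of all the rejected trials only the last one, at \<open>\<tau> / 2\<close>, is remembered.
\<close>

lemma backtrack_accepted:
  assumes "backtrack x \<tau>0 r" "r = Accepted y \<tau>" "0 < \<tau>0"
  shows "grad x \<noteq> 0 \<and> (\<exists>s. y = x + s \<and> step_at x \<tau> s \<and> ms_test grad x \<tau> s) \<and>
    (\<tau> = \<tau>0 \<or> (2 * \<tau>0 \<le> \<tau> \<and> (\<forall>s. step_at x (\<tau> / 2) s \<longrightarrow> \<not> ms_test grad x (\<tau> / 2) s)))"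
  using assms
proof (induction rule: ms_backtrack.induct)
  case (rejected t r)
  have IH: "grad x \<noteq> 0 \<and> (\<exists>s. y = x + s \<and> step_at x \<tau> s \<and> ms_test grad x \<tau> s) \<and>
    (\<tau> = 2 * t \<or> (2 * (2 * t) \<le> \<tau> \<and> (\<forall>s. step_at x (\<tau> / 2) s \<longrightarrow> \<not> ms_test grad x (\<tau> / 2) s)))"
    by (rule rejected.IH[OF rejected.prems(1)]) (use rejected.prems(2) in simp)
  then show ?case
  proof (elim conjE disjE)
    assume "\<tau> = 2 * t"
    then show ?case using IH rejected.hyps(1,2) by simp
  next
    assume "2 * (2 * t) \<le> \<tau>" "\<forall>s. step_at x (\<tau> / 2) s \<longrightarrow> \<not> ms_test grad x (\<tau> / 2) s"
    then show ?case using IH rejected.prems(2) by simp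
  qed
next
  case (accepted t s)
  then show ?case by blast
qed simp_all

lemma accepted_le_tau_bar:
  assumes x: "x \<in> euclid d" and b: "backtrack x \<tau>0 (Accepted y \<tau>)" "0 < \<tau>0"
  shows "\<tau> \<le> 4 * max \<tau>0 (tau_bar M0 M1 \<delta> \<rho> grad x)"
proof (rule ccontr)
  assume neg: "\<not> ?thesis"
  have big: "2 * \<tau>0 \<le> \<tau>" and rej: "\<And>s. step_at x (\<tau> / 2) s \<Longrightarrow> \<not> ms_test grad x (\<tau> / 2) s"
    using backtrack_accepted[OF b(1) refl b(2)] neg b(2) by auto
  have "4 * \<delta> \<le> tau_bar M0 M1 \<delta> \<rho> grad x" by (simp add: tau_bar_def)
  then have "\<delta> < \<tau> / 2" using big b(2) neg by linarith
  then obtain s where s: "step_at x (\<tau> / 2) s"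
    using regularized_step_exists[OF x] by blast
  have "ms_test grad x (\<tau> / 2) s"
    by (rule large_\<tau>_accepted[OF x s]) (use neg big b(2) in auto)
  then show False using rej[OF s] by blast
qed

text \<open>
  Both steps solve a regularized system with the same right-hand side, so their difference solves
  \<open>(H x + \<tau>/2) (s' - s) = (\<tau>/2) s\<close>, and \<open>H x + \<tau>/2\<close> is bounded below by \<open>3\<tau>/8\<close>.
\<close>

lemma halved_step_norm_le:
  assumes x: "x \<in> euclid d" and s: "step_at x \<tau> s" and s': "step_at x (\<tau> / 2) s'"
    and \<tau>: "0 < \<tau>" "8 * \<delta> \<le> \<tau>"
  shows "3 * norm s' \<le> 7 * norm s"
proof -
  have "s' - s \<in> euclid d" by (intro in_euclid_intros step_in[OF s] step_in[OF s'])
  from regularized_norm_lower[OF x this, of "\<tau> / 2"]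
  have "(\<tau> / 2 - \<delta>) * norm (s' - s) \<le> norm (H x (s' - s) + (\<tau> / 2) *\<^sub>R (s' - s))" .
  also have "H x (s' - s) + (\<tau> / 2) *\<^sub>R (s' - s) = (\<tau> / 2) *\<^sub>R s"
  proof -
    have "\<tau> *\<^sub>R s = (\<tau> / 2) *\<^sub>R s + (\<tau> / 2) *\<^sub>R s" by (simp flip: scaleR_add_left)
    then show ?thesis
      using step_eq[OF s] step_eq[OF s'] by (simp add: blinfun.diff_right algebra_simps)
  qed
  finally have "(\<tau> / 2 - \<delta>) * norm (s' - s) \<le> \<tau> / 2 * norm s" using \<tau> by simp
  moreover have "3 / 8 * \<tau> * norm (s' - s) \<le> (\<tau> / 2 - \<delta>) * norm (s' - s)"
    using \<tau> by (intro mult_right_mono) auto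
  ultimately have "\<tau> * (3 * norm (s' - s)) \<le> \<tau> * (4 * norm s)" by simp
  then have "3 * norm (s' - s) \<le> 4 * norm s" using \<tau> by simp
  moreover have "norm s' \<le> norm (s' - s) + norm s"
    using norm_triangle_ineq[of "s' - s" s] by simp
  ultimately show ?thesis by simp
qed

text \<open>
  The alternatives for the rejected trial at \<open>\<tau> / 2\<close>, transferred to the accepted step \<open>s\<close>, which is
  at least \<open>3/7\<close> times as long.
\<close>

lemma damped_step_long:
  assumes x: "x \<in> euclid d" and s: "step_at x \<tau> s" and \<tau>: "0 < \<tau>"
    and rej: "\<And>s'. step_at x (\<tau> / 2) s' \<Longrightarrow> \<not> ms_test grad x (\<tau> / 2) s'"
  shows "\<tau> \<le> 8 * \<delta> \<or> \<rho> < ereal (7 / 3 * norm s) \<or> 1 < 131 * M1 * (norm s)\<^sup>2 \<or> \<tau> < 75 * M0 * norm s"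
proof (cases "\<tau> \<le> 8 * \<delta>")
  case False
  then have "\<delta> < \<tau> / 2" using \<delta>_nonneg by simp
  then obtain s' where s': "step_at x (\<tau> / 2) s'"
    using regularized_step_exists[OF x] by blast
  have n: "norm s' \<le> 7 / 3 * norm s"
    using halved_step_norm_le[OF x s s'] \<tau> False by simp
  consider "\<rho> < ereal (norm s')" | (M1) "1 < 24 * M1 * (norm s')\<^sup>2" | (M0) "\<tau> / 2 < 16 * M0 * norm s'"
    using rejected_trial[OF x s' _ _ rej[OF s']] \<tau> False by auto
  then show ?thesis
  proof cases
    case 1
    then show ?thesis using n by (meson ereal_less_eq(3) less_le_trans)
  next
    case M1
    have "24 * M1 * (norm s')\<^sup>2 \<le> 24 * M1 * (7 / 3 * norm s)\<^sup>2"
      using n M1_nonneg by (intro mult_left_mono power_mono) auto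
    also have "\<dots> = 392 / 3 * (M1 * (norm s)\<^sup>2)"
      by (simp add: power2_eq_square)
    also have "\<dots> \<le> 131 * (M1 * (norm s)\<^sup>2)"
      using M1_nonneg by (intro mult_right_mono) auto
    finally have "24 * M1 * (norm s')\<^sup>2 \<le> 131 * M1 * (norm s)\<^sup>2"
      by (simp add: mult.assoc)
    then show ?thesis using M1 by linarith
  next
    case M0
    have "32 * (M0 * norm s') \<le> 32 * (M0 * (7 / 3 * norm s))"
      using n M0_nonneg by (intro mult_left_mono) auto
    moreover have "0 \<le> M0 * norm s" using M0_nonneg by simp
    ultimately have "\<tau> < 75 * (M0 * norm s)" using M0 by simp
    then show ?thesis by (simp add: mult.assoc)
  qed
qed simp

end

section \<open>Growth of the weights\<close>

text \<open>
  The next three lemmas measure the growth of the weight in an undamped step, where the increment \<open>a\<close>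
  is the positive root of \<open>\<eta> a\<^sup>2 = A + a\<close>.  They show which function of \<open>A\<close> gains a fixed amount when \<open>\<eta>\<close>,
  \<open>\<eta> A\<close> or \<open>\<eta>\<^sup>3 A\<close>, respectively, is bounded: the square root, the logarithm and the cube root.
\<close>

lemma sqrt_growth:
  assumes pos: "0 < A" "0 < a" "0 < \<eta>" and eq: "\<eta> * a\<^sup>2 = A + a"
  shows "1 \<le> 2 * sqrt \<eta> * (sqrt (A + a) - sqrt A)"
proof -
  define x y h where "x = sqrt (A + a)" "y = sqrt A" "h = sqrt \<eta>"
  have xy: "0 < y" "y < x" "0 < h" "x * x - y * y = a"
    using pos unfolding x_y_h_def by auto
  have hx: "h * a = x"
    using pos unfolding x_y_h_def eq[symmetric] by (simp add: real_sqrt_mult)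
  have "x = h * (x - y) * (x + y)"
    using hx xy(4) by (simp add: algebra_simps)
  also have "\<dots> \<le> h * (x - y) * (2 * x)"
    using xy by (intro mult_left_mono) auto
  finally have "x * 1 \<le> x * (2 * h * (x - y))"
    by (simp add: mult_ac)
  then show ?thesis
    using xy by (simp add: x_y_h_def)
qed

lemma ln_growth:
  assumes pos: "0 < A" "0 < a" "0 < \<eta>" and eq: "\<eta> * a\<^sup>2 = A + a"
  shows "1 \<le> sqrt (\<eta> * (A + a)) * (ln (A + a) - ln A)"
proof -
  have "sqrt (\<eta> * (A + a)) = \<eta> * a"
    using pos by (simp add: eq[symmetric] real_sqrt_mult real_sqrt_unique power2_eq_square mult_ac)
  moreover have "a / (A + a) \<le> ln (A + a) - ln A"
  proof -
    have "ln (A / (A + a)) \<le> A / (A + a) - 1"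
      using pos by (intro ln_le_minus_one) auto
    then show ?thesis
      using pos by (simp add: ln_div field_simps)
  qed
  then have "\<eta> * a * (a / (A + a)) \<le> \<eta> * a * (ln (A + a) - ln A)"
    using pos by (intro mult_left_mono) auto
  moreover have "\<eta> * a * (a / (A + a)) = 1"
    using pos eq by (simp add: field_simps power2_eq_square)
  ultimately show ?thesis by metis
qed

text \<open>
  The cube root is the only power of \<open>A\<close> whose increment, of order \<open>A\<^bsup>-2/3\<^esup> a\<close> with
  \<open>a = sqrt ((A + a) / \<eta>)\<close>, depends on \<open>\<eta>\<^sup>3 A\<close> alone.
\<close>

lemma cube_root_growth:
  assumes pos: "0 < A" "0 < a" "0 < \<eta>" "0 < C" "0 < P" and eq: "\<eta> * a\<^sup>2 = A + a"
    and small: "C\<^sup>2 / P ^ 6 * (\<eta> ^ 3 * (A + a)) \<le> 1"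
  shows "1 \<le> 3 * P * (root 3 (A + a) / root 3 C - root 3 A / root 3 C)"
proof -
  define x y z where "x = root 3 (A + a)" "y = root 3 A" "z = root 3 C"
  have xyz: "0 < y" "y < x" "0 < z" "x ^ 3 = A + a" "y ^ 3 = A" "z ^ 3 = C"
    using pos unfolding x_y_z_def by (auto simp: real_root_pow_pos2)
  have "(z\<^sup>2 * \<eta> * x) ^ 3 \<le> (P\<^sup>2) ^ 3"
  proof -
    have "(z\<^sup>2 * \<eta> * x) ^ 3 = (z ^ 3)\<^sup>2 * (\<eta> ^ 3 * x ^ 3)"
      by (simp add: power_mult_distrib mult_ac flip: power_mult)
    also have "\<dots> = C\<^sup>2 * (\<eta> ^ 3 * (A + a))"
      using xyz by simp
    also have "\<dots> \<le> P ^ 6"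
      using small pos by (simp add: field_simps)
    finally show ?thesis by (simp flip: power_mult)
  qed
  then have zx: "z\<^sup>2 * \<eta> * x \<le> P\<^sup>2"
    using power_le_imp_le_base[of "z\<^sup>2 * \<eta> * x" 2 "P\<^sup>2"] by (simp add: numeral_3_eq_3)
  have a: "a \<le> 3 * x\<^sup>2 * (x - y)"
  proof -
    have "a = (x - y) * (x * x + x * y + y * y)"
      using xyz(4,5) by (simp add: algebra_simps power3_eq_cube)
    also have "\<dots> \<le> (x - y) * (x * x + x * x + x * x)"
      using xyz by (intro mult_left_mono add_mono mult_mono) auto
    finally show ?thesis by (simp add: algebra_simps power2_eq_square)
  qed
  have "(z * x\<^sup>2)\<^sup>2 * \<eta> \<le> (P * a)\<^sup>2 * \<eta>"
  proof -
    have "(z * x\<^sup>2)\<^sup>2 * \<eta> = (z\<^sup>2 * \<eta> * x) * x ^ 3"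
      by (simp add: power2_eq_square power3_eq_cube mult_ac)
    also have "\<dots> \<le> P\<^sup>2 * x ^ 3"
      using zx xyz(4) pos by (intro mult_right_mono) auto
    also have "\<dots> = (P * a)\<^sup>2 * \<eta>"
      using xyz(4) eq by (simp add: power_mult_distrib mult_ac)
    finally show ?thesis .
  qed
  then have "(z * x\<^sup>2)\<^sup>2 \<le> (P * a)\<^sup>2"
    using pos by simp
  then have "z * x\<^sup>2 \<le> P * a"
    by (rule power2_le_imp_le) (use pos in auto)
  also have "\<dots> \<le> P * (3 * x\<^sup>2 * (x - y))"
    using a pos by (intro mult_left_mono) auto
  also have "\<dots> = x\<^sup>2 * (3 * P * (x - y))"
    by (simp only: mult_ac)
  finally have "x\<^sup>2 * z \<le> x\<^sup>2 * (3 * P * (x - y))"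
    by (simp only: mult.commute)
  then have "z \<le> 3 * P * (x - y)"
    using xyz by simp
  then show ?thesis
    using xyz by (simp add: x_y_z_def[symmetric] field_simps)
qed

text \<open>
  What the analysis of a run keeps of the method: weights \<open>A\<close>, predicted regularizations \<open>\<eta>\<close>, and the
  energy \<open>e\<close> in units of \<open>R\<^sup>2\<close>.  A step is either a success, which halves \<open>\<eta>\<close> and adds the full increment,
  or a failure, which doubles \<open>\<eta>\<close> and, unless \<open>\<eta>\<close> is of order \<open>\<delta>\<close>, is paid for with energy.  The
  parameter \<open>m\<close> stands for \<open>M0 R\<close>, and \<open>P\<close> is the size of the index \<open>T\<close> that the final weight allows.
\<close>

locale damped_weights =
  fixes A \<eta> e :: "nat \<Rightarrow> real" and B \<delta> m P :: real and T :: nat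
  assumes B_ge_1: "1 \<le> B" and P_ge_B: "B \<le> P" and T_ge_1: "1 \<le> T" and \<delta>_nonneg: "0 \<le> \<delta>"
    and A_pos: "\<And>k. 1 \<le> k \<Longrightarrow> k \<le> T \<Longrightarrow> 0 < A k"
    and \<eta>_pos: "\<And>k. 1 \<le> k \<Longrightarrow> k \<le> T \<Longrightarrow> 0 < \<eta> k"
    and e_nonneg: "\<And>k. 1 \<le> k \<Longrightarrow> k \<le> T \<Longrightarrow> 0 \<le> e k"
    and e_1: "e 1 \<le> 1 / 2" and A_1: "A 1 * \<eta> 1 = 1"
    and step: "\<And>k. 1 \<le> k \<Longrightarrow> k < T \<Longrightarrow> A k \<le> A (Suc k) \<and> e (Suc k) \<le> e k \<and>
      ((\<eta> (Suc k) = \<eta> k / 2 \<and> (\<exists>a>0. A (Suc k) = A k + a \<and> \<eta> k * a\<^sup>2 = A k + a)) \<or>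
       (\<eta> (Suc k) = 2 * \<eta> k \<and> (\<eta> k \<le> 4 * \<delta> \<or>
          \<eta> k * A (Suc k) \<le> 30 * B ^ 3 * (e k - e (Suc k)) \<or>
          \<eta> k ^ 3 * A (Suc k) \<le> 4000 * m\<^sup>2 * (e k - e (Suc k)))))"
    and target_m: "(m * A T)\<^sup>2 \<le> P ^ 7" and target_\<delta>: "\<delta> * A T \<le> P\<^sup>2"
begin

definition \<mu> :: real where "\<mu> = (A T)\<^sup>2 / P ^ 6"

text \<open>
  Measures how far \<open>\<eta>\<close> lies above the levels at which a success brings enough growth of the weight: it is of
  order 1 or larger only if \<open>\<eta> > 8 \<delta>\<close> and neither \<open>\<eta> A\<close> nor \<open>\<eta>\<^sup>3 A\<close> is small.  Failures raise it at the expense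
  of energy; a success without enough growth at least halves it, up to the change of \<open>A\<close>.
  The cutoff \<open>8 \<delta>\<close> is twice the largest \<open>\<eta>\<close> at which a failure can be free of cost.
\<close>

definition excess :: "real \<Rightarrow> real \<Rightarrow> real" where
  "excess x a = (if x \<le> 8 * \<delta> then 0 else min (x * a / B\<^sup>2) (\<mu> * x ^ 3 * a))"

text \<open>
  The first three terms reward the growth of the weight in the three profitable regimes, each normalized
  so that its total gain over the run is \<open>O(P + B ln (A T / A 1))\<close>.  The excess is subtracted, so that
  lowering it counts as progress, and the energy pays for raising it.  The factor \<open>132 = 4 (1 + 4 * 8)\<close>
  leaves a gain of 1 after an increase of the excess by 8, and \<open>128000 = 4 * 32000\<close> matches
  the increase of the excess per unit of energy in \<open>potential_failure\<close>.
\<close>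

definition potential :: "nat \<Rightarrow> real" where
  "potential k = 132 * B * ln (A k) + 6 * P * (root 3 (A k) / root 3 (A T))
     + 2 * sqrt (8 * \<delta>) * sqrt (A k) - 4 * excess (\<eta> k) (A k) - 128000 * P * e k"

lemma P_ge_1: "1 \<le> P" using B_ge_1 P_ge_B by simp

lemma AT_pos: "0 < A T" using A_pos T_ge_1 by simp

lemma \<mu>_pos: "0 < \<mu>" unfolding \<mu>_def using AT_pos P_ge_1 by (intro divide_pos_pos) auto

lemma excess_nonneg: "0 \<le> x \<Longrightarrow> 0 \<le> a \<Longrightarrow> 0 \<le> excess x a"
  using B_ge_1 \<mu>_pos by (simp add: excess_def)

lemma excess_le:
  assumes "0 \<le> x" "0 \<le> a"
  shows "excess x a \<le> x * a / B\<^sup>2" "excess x a \<le> \<mu> * x ^ 3 * a"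
  using assms B_ge_1 \<mu>_pos by (auto simp: excess_def)

lemma A_mono: "1 \<le> j \<Longrightarrow> j \<le> k \<Longrightarrow> k \<le> T \<Longrightarrow> A j \<le> A k"
proof (induction k)
  case (Suc k)
  then show ?case
    using step[of k] by (cases "j = Suc k") force+
qed simp

lemma e_le: "1 \<le> k \<Longrightarrow> k \<le> T \<Longrightarrow> e k \<le> 1 / 2"
proof (induction k)
  case (Suc k)
  then show ?case
    using step[of k] e_1 by (cases "k = 0") force+
qed simp

lemma potential_other_terms_mono:
  assumes k: "1 \<le> k" "k < T"
  shows "132 * B * ln (A k) \<le> 132 * B * ln (A (Suc k))"
    "6 * P * (root 3 (A k) / root 3 (A T)) \<le> 6 * P * (root 3 (A (Suc k)) / root 3 (A T))"
    "2 * sqrt (8 * \<delta>) * sqrt (A k) \<le> 2 * sqrt (8 * \<delta>) * sqrt (A (Suc k))"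
    "128000 * P * e (Suc k) \<le> 128000 * P * e k"
  using step[OF k] k A_pos[of k] A_pos[of "Suc k"] B_ge_1 P_ge_1 AT_pos \<delta>_nonneg
  by (auto intro!: mult_left_mono divide_right_mono real_sqrt_le_mono)

text \<open>
  A success at a profitable level gains at least 1 from the corresponding growth term; the other
  successes reduce the excess by a quarter of a quantity that is at least 1.
\<close>

lemma potential_success:
  assumes k: "1 \<le> k" "k < T" and a: "0 < a" "A (Suc k) = A k + a" "\<eta> k * a\<^sup>2 = A k + a"
    and half: "\<eta> (Suc k) = \<eta> k / 2"
  shows "1 \<le> potential (Suc k) - potential k"
proof -
  note mono = potential_other_terms_mono[OF k]
  let ?x = "\<eta> k" and ?a = "A k + a"
  have pos: "0 < A k" "0 < ?x" "0 < ?a" using A_pos[of k] \<eta>_pos[of k] k a by auto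
  have old: "0 \<le> excess ?x (A k)" using pos by (simp add: excess_nonneg)
  have new: "excess (\<eta> (Suc k)) (A (Suc k)) \<le> ?x * ?a / B\<^sup>2 / 2"
    "excess (\<eta> (Suc k)) (A (Suc k)) \<le> \<mu> * ?x ^ 3 * ?a / 8"
    using excess_le[of "?x / 2" ?a] pos unfolding half a(2) by (auto simp: power_divide)
  consider (inexact) "?x \<le> 8 * \<delta>" | (small) "?x * ?a \<le> 16 * B\<^sup>2" | (flat) "\<mu> * (?x ^ 3 * ?a) \<le> 1"
    | (excessive) "?x > 8 * \<delta>" "?x * ?a > 16 * B\<^sup>2" "\<mu> * (?x ^ 3 * ?a) > 1"
    by linarith
  then show ?thesis
  proof cases
    case inexact
    have "1 \<le> 2 * sqrt ?x * (sqrt ?a - sqrt (A k))"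
      by (rule sqrt_growth) (use pos a in auto)
    also have "\<dots> \<le> 2 * sqrt (8 * \<delta>) * (sqrt ?a - sqrt (A k))"
      using inexact a by (intro mult_right_mono mult_left_mono) auto
    finally have "1 \<le> 2 * sqrt (8 * \<delta>) * sqrt (A (Suc k)) - 2 * sqrt (8 * \<delta>) * sqrt (A k)"
      using a by (simp add: algebra_simps)
    moreover have "excess (\<eta> (Suc k)) (A (Suc k)) = 0"
      using inexact half \<delta>_nonneg by (simp add: excess_def)
    ultimately show ?thesis
      using mono old unfolding potential_def by linarith
  next
    case small
    have "1 \<le> sqrt (?x * ?a) * (ln ?a - ln (A k))"
      by (rule ln_growth) (use pos a in auto)
    also have "\<dots> \<le> (4 * B) * (ln ?a - ln (A k))"
      using small a pos B_ge_1
      by (intro mult_right_mono real_le_lsqrt) (auto simp: power_mult_distrib)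
    finally have "33 \<le> 132 * B * ln (A (Suc k)) - 132 * B * ln (A k)"
      using a by (simp add: algebra_simps)
    moreover have "?x * ?a / B\<^sup>2 / 2 \<le> 8"
      using small B_ge_1 by (simp add: field_simps)
    ultimately show ?thesis
      using mono old new(1) unfolding potential_def by linarith
  next
    case flat
    have "1 \<le> 3 * P * (root 3 ?a / root 3 (A T) - root 3 (A k) / root 3 (A T))"
      by (rule cube_root_growth[of _ _ ?x]) (use pos a AT_pos P_ge_1 flat in \<open>auto simp: \<mu>_def\<close>)
    then have "2 * 1 \<le> 2 * (3 * P * (root 3 ?a / root 3 (A T) - root 3 (A k) / root 3 (A T)))"
      by (intro mult_left_mono) auto
    then have "2 \<le> 6 * P * (root 3 (A (Suc k)) / root 3 (A T))
        - 6 * P * (root 3 (A k) / root 3 (A T))"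
      unfolding a(2) right_diff_distrib by simp
    moreover have "\<mu> * ?x ^ 3 * ?a / 8 \<le> 1 / 8"
      using flat unfolding mult.assoc by (rule divide_right_mono) simp
    ultimately show ?thesis
      using mono old new(2) unfolding potential_def by linarith
  next
    case excessive
    have quarter: "4 * a \<le> ?a"
    proof -
      have "4\<^sup>2 \<le> ?x * ?a"
        using excessive(2) one_le_power[OF B_ge_1, of 2] by simp
      also have "\<dots> = (?x * a)\<^sup>2"
        by (simp add: a(3)[symmetric] power2_eq_square mult_ac)
      finally have "4 \<le> ?x * a"
        by (rule power2_le_imp_le) (use pos a in auto)
      then have "4 * a \<le> ?x * a * a"
        using a by (intro mult_right_mono) auto
      then show ?thesis
        using a(3) by (simp add: power2_eq_square mult.assoc)
    qed
    define b where "b = min (?x * ?a / B\<^sup>2) (\<mu> * ?x ^ 3 * ?a)"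
    have "1 \<le> b"
    proof -
      have "B\<^sup>2 \<le> ?x * ?a"
        using excessive(2) zero_le_power2[of B] by linarith
      then show ?thesis
        using excessive(3) B_ge_1 unfolding b_def by (simp add: le_divide_eq mult.assoc)
    qed
    have "3 / 4 * b \<le> excess ?x (A k)"
    proof -
      have A_large: "3 / 4 * ?a \<le> A k" using quarter by simp
      have "3 / 4 * (?x * ?a / B\<^sup>2) = ?x / B\<^sup>2 * (3 / 4 * ?a)" by (simp add: field_simps)
      also have "\<dots> \<le> ?x / B\<^sup>2 * A k"
        using A_large pos by (intro mult_left_mono) auto
      finally have "3 / 4 * (?x * ?a / B\<^sup>2) \<le> ?x * A k / B\<^sup>2" by simp
      moreover have "3 / 4 * (\<mu> * ?x ^ 3 * ?a) \<le> \<mu> * ?x ^ 3 * A k"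
      proof -
        have "3 / 4 * (\<mu> * ?x ^ 3 * ?a) = \<mu> * ?x ^ 3 * (3 / 4 * ?a)" by simp
        also have "\<dots> \<le> \<mu> * ?x ^ 3 * A k"
          using A_large pos \<mu>_pos by (intro mult_left_mono) auto
        finally show ?thesis .
      qed
      moreover have "3 / 4 * b \<le> 3 / 4 * (?x * ?a / B\<^sup>2)"
          "3 / 4 * b \<le> 3 / 4 * (\<mu> * ?x ^ 3 * ?a)"
        by (intro mult_left_mono; simp add: b_def)+
      ultimately have "3 / 4 * b \<le> ?x * A k / B\<^sup>2" "3 / 4 * b \<le> \<mu> * ?x ^ 3 * A k"
        by (blast intro: order_trans)+
      then show ?thesis
        using excessive(1) by (simp add: excess_def)
    qed
    moreover have "excess (\<eta> (Suc k)) (A (Suc k)) \<le> b / 2"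
    proof -
      have "0 \<le> \<mu> * ?x ^ 3 * ?a" using pos \<mu>_pos by simp
      then show ?thesis using new unfolding b_def by linarith
    qed
    ultimately show ?thesis
      using mono \<open>1 \<le> b\<close> unfolding potential_def by linarith
  qed
qed

text \<open>
  The excess after a failure is at most a multiple of \<open>P\<close> times the energy spent.  In the \<open>m\<close>-case this
  uses \<open>\<mu> m\<^sup>2 \<le> P\<close>, which is the first target inequality.
\<close>

lemma potential_failure:
  assumes k: "1 \<le> k" "k < T" and double: "\<eta> (Suc k) = 2 * \<eta> k"
    and cost: "\<eta> k \<le> 4 * \<delta> \<or> \<eta> k * A (Suc k) \<le> 30 * B ^ 3 * (e k - e (Suc k)) \<or>
      \<eta> k ^ 3 * A (Suc k) \<le> 4000 * m\<^sup>2 * (e k - e (Suc k))"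
  shows "potential k \<le> potential (Suc k)"
proof -
  note mono = potential_other_terms_mono[OF k]
  let ?x = "\<eta> k" and ?a = "A (Suc k)" and ?D = "e k - e (Suc k)"
  have pos: "0 < ?x" "0 < ?a" "0 \<le> ?D" "0 < A k" using A_pos \<eta>_pos k step[OF k] by auto
  have old: "0 \<le> excess ?x (A k)" using pos by (simp add: excess_nonneg)
  note new = excess_le[of "2 * ?x" ?a, folded double]
  have "excess (\<eta> (Suc k)) ?a \<le> 32000 * P * ?D"
    using cost
  proof (elim disjE)
    assume "?x \<le> 4 * \<delta>"
    then have "excess (\<eta> (Suc k)) ?a = 0" using double by (simp add: excess_def)
    then show ?thesis using pos P_ge_1 by simp
  next
    assume *: "?x * ?a \<le> 30 * B ^ 3 * ?D"
    have "excess (\<eta> (Suc k)) ?a \<le> \<eta> (Suc k) * ?a / B\<^sup>2"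
      using new(1) pos double by simp
    also have "\<dots> \<le> 60 * B ^ 3 * ?D / B\<^sup>2"
      using * double by (intro divide_right_mono) auto
    also have "\<dots> = 60 * (B * ?D)"
      using B_ge_1 by (simp add: power2_eq_square power3_eq_cube)
    also have "\<dots> \<le> 32000 * (P * ?D)"
      using P_ge_B pos B_ge_1 by (intro mult_mono) auto
    finally show ?thesis by (simp add: mult.assoc)
  next
    assume *: "?x ^ 3 * ?a \<le> 4000 * m\<^sup>2 * ?D"
    have "excess (\<eta> (Suc k)) ?a \<le> \<mu> * (8 * (?x ^ 3 * ?a))"
      using new(2) pos double by (simp add: power_mult_distrib mult_ac)
    also have "\<dots> \<le> \<mu> * (8 * (4000 * m\<^sup>2 * ?D))"
      using * \<mu>_pos by (intro mult_left_mono) auto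
    also have "\<dots> = 32000 * (\<mu> * m\<^sup>2) * ?D" by simp
    also have "\<dots> \<le> 32000 * P * ?D"
    proof (intro mult_right_mono mult_left_mono)
      have "\<mu> * m\<^sup>2 = (m * A T)\<^sup>2 / P ^ 6" by (simp add: \<mu>_def power_mult_distrib mult_ac)
      also have "\<dots> \<le> P ^ 7 / P ^ 6" using target_m P_ge_1 by (intro divide_right_mono) auto
      also have "\<dots> = P" using P_ge_1 by (simp add: field_simps eval_nat_numeral)
      finally show "\<mu> * m\<^sup>2 \<le> P" .
    qed (use pos in auto)
    finally show ?thesis .
  qed
  then show ?thesis
    using mono(1-3) old unfolding potential_def by (simp add: algebra_simps)
qed

lemma inverse_A_le: "1 \<le> k \<Longrightarrow> k \<le> T \<Longrightarrow> 1 \<le> \<eta> 1 * A k"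
  using mult_left_mono[OF A_mono[of 1 k], of "\<eta> 1"] A_1 \<eta>_pos[of 1] T_ge_1
  by (simp add: mult.commute)

text \<open>
  A failure at level \<open>\<eta>\<close> with weight at least \<open>A 1 = 1 / \<eta> 1\<close> can be afforded only if \<open>\<eta> = O(P\<^sup>3 \<eta> 1)\<close>, since
  the whole energy is at most \<open>1/2\<close>.  So \<open>\<eta>\<close> climbs above its first value \<open>O(ln P)\<close> times only, even if
  the first value happens to be far too small.
\<close>

lemma \<eta>_bound: "1 \<le> k \<Longrightarrow> k \<le> T \<Longrightarrow> \<eta> k \<le> 60 * P ^ 3 * \<eta> 1"
proof (induction k)
  case (Suc k)
  have P: "1 \<le> P ^ 3" "P\<^sup>2 \<le> P ^ 3" "P ^ 7 \<le> P ^ 9" "B ^ 3 \<le> P ^ 3"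
    using P_ge_1 P_ge_B B_ge_1 by (auto intro: power_increasing power_mono)
  have \<eta>1: "0 < \<eta> 1" using \<eta>_pos T_ge_1 by simp
  show ?case
  proof (cases "k = 0")
    case True
    then show ?thesis using P(1) \<eta>1 by simp
  next
    case False
    then have k: "1 \<le> k" "k < T" using Suc.prems by auto
    let ?x = "\<eta> k" and ?D = "e k - e (Suc k)"
    have x: "0 < ?x" using \<eta>_pos k by simp
    have D: "0 \<le> ?D" "?D \<le> 1 / 2"
      using step[OF k] e_nonneg[of "Suc k"] e_le[of k] k by auto
    have ax: "?x ^ n \<le> \<eta> 1 * (?x ^ n * A (Suc k))" for n
      using mult_left_mono[OF inverse_A_le[of "Suc k"], of "?x ^ n"] k x by (simp add: mult_ac)
    consider "\<eta> (Suc k) = ?x / 2" | (a) "\<eta> (Suc k) = 2 * ?x" "?x \<le> 4 * \<delta>"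
      | (c) "\<eta> (Suc k) = 2 * ?x" "?x * A (Suc k) \<le> 30 * B ^ 3 * ?D"
      | (b) "\<eta> (Suc k) = 2 * ?x" "?x ^ 3 * A (Suc k) \<le> 4000 * m\<^sup>2 * ?D"
      using step[OF k] by blast
    then show ?thesis
    proof cases
      case 1
      then show ?thesis using Suc.IH k x by simp
    next
      case a
      have "\<delta> * 1 \<le> \<delta> * (\<eta> 1 * A T)"
        using inverse_A_le[of T] T_ge_1 \<delta>_nonneg by (intro mult_left_mono) auto
      also have "\<dots> \<le> P\<^sup>2 * \<eta> 1"
        using mult_right_mono[OF target_\<delta>, of "\<eta> 1"] \<eta>1 by (simp add: mult_ac)
      also have "\<dots> \<le> P ^ 3 * \<eta> 1"
        using P \<eta>1 by (intro mult_right_mono) auto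
      finally show ?thesis using a P(1) \<eta>1 mult_pos_pos[of "P^3" "\<eta> 1"] by linarith
    next
      case c
      have "?x \<le> \<eta> 1 * (?x * A (Suc k))" using ax[of 1] by simp
      also have "\<dots> \<le> \<eta> 1 * (30 * P ^ 3 * 1)"
      proof (intro mult_left_mono)
        have "30 * B ^ 3 * ?D \<le> 30 * P ^ 3 * 1"
          using D P P_ge_1 B_ge_1 by (intro mult_mono) auto
        with c show "?x * A (Suc k) \<le> 30 * P ^ 3 * 1" by linarith
      qed (use \<eta>1 in auto)
      finally show ?thesis using c by simp
    next
      case b
      have "m\<^sup>2 * 1\<^sup>2 \<le> m\<^sup>2 * (\<eta> 1 * A T)\<^sup>2"
        using inverse_A_le[of T] T_ge_1 by (intro mult_left_mono power_mono) auto
      also have "\<dots> = (\<eta> 1)\<^sup>2 * (m * A T)\<^sup>2" by (simp add: power_mult_distrib)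
      also have "\<dots> \<le> (\<eta> 1)\<^sup>2 * P ^ 9"
        using target_m P by (intro mult_left_mono) auto
      finally have m: "m\<^sup>2 \<le> (\<eta> 1)\<^sup>2 * P ^ 9" by simp
      have "?x ^ 3 \<le> \<eta> 1 * (?x ^ 3 * A (Suc k))" by (rule ax)
      also have "\<dots> \<le> \<eta> 1 * (4000 * ((\<eta> 1)\<^sup>2 * P ^ 9) * (1 / 2))"
      proof (intro mult_left_mono)
        have "4000 * m\<^sup>2 * ?D \<le> 4000 * ((\<eta> 1)\<^sup>2 * P ^ 9) * (1 / 2)"
          using D m P_ge_1 by (intro mult_mono) auto
        with b show "?x ^ 3 * A (Suc k) \<le> 4000 * ((\<eta> 1)\<^sup>2 * P ^ 9) * (1 / 2)" by linarith
      qed (use \<eta>1 in auto)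
      also have "\<dots> = 2000 * (P ^ 3 * \<eta> 1) ^ 3"
        by (simp add: eval_nat_numeral)
      also have "\<dots> \<le> (30 * (P ^ 3 * \<eta> 1)) ^ 3"
        using P_ge_1 \<eta>1 by (simp add: power_mult_distrib)
      finally have "?x \<le> 30 * (P ^ 3 * \<eta> 1)"
        using power_le_imp_le_base[of ?x 2 "30 * (P ^ 3 * \<eta> 1)"] P_ge_1 \<eta>1
        by (simp add: numeral_3_eq_3)
      then show ?thesis unfolding b(1) by (simp add: mult_ac)
    qed
  qed
qed simp

text \<open>
  A success gains at least 1 in the potential, so \<open>2 potential + log 2 \<eta>\<close> gains at least 1 in every step, and the
  length of the run is bounded by the total change of this sum.  A failure contributes through the logarithm
  alone, which is why \<open>\<eta>_bound\<close> is needed.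
\<close>

theorem length_bound: "real T \<le> 130000 * (P + B * ln (A T / A 1))"
proof -
  let ?G = "\<lambda>k. 2 * potential k + log 2 (\<eta> k)"
  have inc: "1 \<le> ?G (Suc k) - ?G k" if k: "1 \<le> k" "k < T" for k
  proof -
    have x: "0 < \<eta> k" using \<eta>_pos k by simp
    show ?thesis
      using step[OF k]
    proof (elim conjE disjE exE)
      fix a assume a: "\<eta> (Suc k) = \<eta> k / 2" "0 < a" "A (Suc k) = A k + a" "\<eta> k * a\<^sup>2 = A k + a"
      have "log 2 (\<eta> (Suc k)) = log 2 (\<eta> k) - 1" unfolding a(1) using x by (simp add: log_divide)
      then show ?thesis using potential_success[OF k a(2-4,1)] by simp
    next
      assume a: "\<eta> (Suc k) = 2 * \<eta> k"
      have "log 2 (\<eta> (Suc k)) = 1 + log 2 (\<eta> k)" using a x by (simp add: log_mult)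
      moreover have "potential k \<le> potential (Suc k)"
        if "\<eta> k \<le> 4 * \<delta> \<or> \<eta> k * A (Suc k) \<le> 30 * B ^ 3 * (e k - e (Suc k)) \<or>
          \<eta> k ^ 3 * A (Suc k) \<le> 4000 * m\<^sup>2 * (e k - e (Suc k))"
        using potential_failure[OF k a that] .
      ultimately show "\<eta> k \<le> 4 * \<delta> \<Longrightarrow> ?thesis"
        "\<eta> k * A (Suc k) \<le> 30 * B ^ 3 * (e k - e (Suc k)) \<Longrightarrow> ?thesis"
        "\<eta> k ^ 3 * A (Suc k) \<le> 4000 * m\<^sup>2 * (e k - e (Suc k)) \<Longrightarrow> ?thesis"
        by auto
    qed
  qed
  have "real k - 1 \<le> ?G k - ?G 1" if "1 \<le> k" "k \<le> T" for k
    using that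
  proof (induction k)
    case (Suc k)
    then show ?case using inc[of k] by (cases "k = 0") auto
  qed simp
  then have T: "real T - 1 \<le> 2 * (potential T - potential 1) + (log 2 (\<eta> T) - log 2 (\<eta> 1))"
    using T_ge_1 by force
  have A1: "0 < A 1" "0 < \<eta> 1" "0 < \<eta> T" using A_pos \<eta>_pos T_ge_1 by auto
  have "log 2 (\<eta> T) - log 2 (\<eta> 1) \<le> 130 * P"
  proof -
    have "log 2 (\<eta> T) - log 2 (\<eta> 1) = log 2 (\<eta> T / \<eta> 1)" using A1 by (simp add: log_divide)
    also have "\<dots> \<le> log 2 (60 * P ^ 3)"
      using \<eta>_bound[of T] T_ge_1 A1 P_ge_1 by (simp add: divide_le_eq)
    also have "\<dots> = (ln 60 + 3 * ln P) / ln 2"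
      using P_ge_1 by (simp add: log_def ln_mult ln_realpow)
    also have "\<dots> \<le> (59 + 3 * P) / (1 / 2)"
    proof (rule frac_le)
      show "ln 60 + 3 * ln P \<le> 59 + 3 * P"
        using ln_le_minus_one[of 60] ln_le_minus_one[of P] P_ge_1 by simp
      show "1 / 2 \<le> ln (2::real)" using ln2_ge_two_thirds by simp
    qed (use P_ge_1 in auto)
    also have "\<dots> \<le> 130 * P" using P_ge_1 by simp
    finally show ?thesis .
  qed
  moreover have "potential T - potential 1 \<le> 64016 * P + 132 * B * ln (A T / A 1)"
  proof -
    have "excess (\<eta> 1) (A 1) \<le> 1"
      using excess_le(1)[of "\<eta> 1" "A 1"] A1 A_1 B_ge_1
      by (auto simp: mult.commute intro: order_trans)
    moreover have "0 \<le> excess (\<eta> T) (A T)" using A1 AT_pos by (simp add: excess_nonneg)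
    moreover have "P * e 1 \<le> P * (1 / 2)" "0 \<le> P * e T"
      using e_1 e_nonneg[of T] T_ge_1 P_ge_1 by (auto intro!: mult_left_mono mult_nonneg_nonneg)
    moreover have "sqrt (8 * \<delta>) * sqrt (A T) \<le> 3 * P"
    proof -
      have "sqrt (8 * \<delta>) * sqrt (A T) = sqrt (8 * (\<delta> * A T))" by (simp add: real_sqrt_mult)
      also have "\<dots> \<le> 3 * P"
      proof (rule real_le_lsqrt)
        have "0 \<le> P\<^sup>2" by simp
        with target_\<delta> have "8 * (\<delta> * A T) \<le> 9 * P\<^sup>2" by linarith
        then show "8 * (\<delta> * A T) \<le> (3 * P)\<^sup>2" by (simp add: power_mult_distrib)
      qed (use P_ge_1 in simp)
      finally show ?thesis .
    qed
    moreover have "0 \<le> sqrt (8 * \<delta>) * sqrt (A 1)" using A1 \<delta>_nonneg by simp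
    moreover have "P * (root 3 (A T) / root 3 (A T)) = P" "0 \<le> P * (root 3 (A 1) / root 3 (A T))"
      using AT_pos A1 P_ge_1 by auto
    moreover have "132 * B * ln (A T / A 1) = 132 * B * ln (A T) - 132 * B * ln (A 1)"
      using AT_pos A1 by (simp add: ln_div algebra_simps)
    ultimately show ?thesis
      using P_ge_1 unfolding potential_def by linarith
  qed
  moreover have "0 \<le> B * ln (A T / A 1)"
    using A_mono[of 1 T] T_ge_1 A1 B_ge_1 by (intro mult_nonneg_nonneg ln_ge_zero) auto
  ultimately show ?thesis
    using T P_ge_1 by (simp add: algebra_simps)
qed

end

section \<open>Energy of a damped step\<close>

text \<open>
  The tangent inequality at \<open>y\<close>, tested at \<open>w\<close> with weight \<open>\<gamma> A\<close> and at \<open>xs\<close> with weight \<open>\<gamma> a'\<close>, bounds the change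
  of energy by \<open>\<gamma> (A + a') (g \<bullet> s) + (\<gamma> a')\<^sup>2 \<bar>g\<bar>\<^sup>2 / 2\<close>, where \<open>s = y - v\<close>.  Damping by \<open>\<gamma> = \<eta> / \<tau>\<close> turns
  \<open>\<eta> a'\<^sup>2 = A + a'\<close> into \<open>\<tau> (\<gamma> a')\<^sup>2 = \<gamma> (A + a')\<close>, so the bound is a multiple of
  \<open>2 \<tau> (g \<bullet> s) + \<bar>g\<bar>\<^sup>2\<close>, which the acceptance test makes at most \<open>-3/4 \<tau>\<^sup>2 \<bar>s\<bar>\<^sup>2\<close>.
  The initialization is the case \<open>A = 0\<close>.
\<close>

lemma monteiro_svaiter_energy_decrease:
  fixes w z v y g xs :: "'a::real_inner"
  assumes pos: "0 \<le> A" "0 < a'" "0 < \<eta>" "\<eta> \<le> \<tau>"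
    and v: "(A + a') *\<^sub>R v = A *\<^sub>R w + a' *\<^sub>R z" and a': "\<eta> * a'\<^sup>2 = A + a'"
    and \<gamma>: "\<gamma> = \<eta> / \<tau>"
    and test: "norm (g + \<tau> *\<^sub>R (y - v)) \<le> \<tau> / 2 * norm (y - v)"
    and below_w: "0 < A \<Longrightarrow> fy + g \<bullet> (w - y) \<le> fw" and below_xs: "fy + g \<bullet> (xs - y) \<le> fs"
    and avg: "(A + \<gamma> * a') * fw' \<le> (1 - \<gamma>) * A * fw + \<gamma> * (A + a') * fy"
  shows "(A + \<gamma> * a') * (fw' - fs) + (norm (z - (\<gamma> * a') *\<^sub>R g - xs))\<^sup>2 / 2
    \<le> A * (fw - fs) + (norm (z - xs))\<^sup>2 / 2 - 3 / 8 * (\<eta> * (A + a') * (norm (y - v))\<^sup>2)"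
proof -
  define s where "s = y - v"
  have \<tau>: "0 < \<tau>" and \<gamma>01: "0 < \<gamma>" "\<gamma> * \<tau> = \<eta>" using pos \<gamma> by auto
  have A': "0 < A + a'" using pos by simp
  have ms: "2 * \<tau> * (g \<bullet> s) + (norm g)\<^sup>2 + 3 / 4 * \<tau>\<^sup>2 * (norm s)\<^sup>2 \<le> 0"
  proof -
    have "(norm (g + \<tau> *\<^sub>R s))\<^sup>2 \<le> (\<tau> / 2 * norm s)\<^sup>2"
      using test by (intro power_mono) (auto simp: s_def)
    moreover have "(norm (g + \<tau> *\<^sub>R s))\<^sup>2 = (norm g)\<^sup>2 + 2 * \<tau> * (g \<bullet> s) + \<tau>\<^sup>2 * (norm s)\<^sup>2"
      unfolding power2_norm_eq_inner
      by (simp only: inner_add_left inner_add_right inner_scaleR_left inner_scaleR_right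
          inner_commute[of s g]) (simp add: power2_eq_square algebra_simps)
    moreover have "(\<tau> / 2 * norm s)\<^sup>2 = \<tau>\<^sup>2 * (norm s)\<^sup>2 / 4"
      by (simp add: power2_eq_square)
    ultimately show ?thesis by simp
  qed
  have "\<gamma> * A * (fy - fw) \<le> \<gamma> * A * (g \<bullet> (y - w))"
    using below_w pos \<gamma>01 by (cases "A = 0") (auto simp: inner_diff_right)
  moreover have "\<gamma> * a' * (fy - fs) \<le> \<gamma> * a' * (g \<bullet> (y - xs))"
    using below_xs pos \<gamma>01 by (auto simp: inner_diff_right)
  moreover have "\<gamma> * A * (g \<bullet> (y - w)) + \<gamma> * a' * (g \<bullet> (y - xs))
      = \<gamma> * (A + a') * (g \<bullet> s) + \<gamma> * a' * (g \<bullet> (z - xs))"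
  proof -
    have "A * (g \<bullet> w) + a' * (g \<bullet> z) = (A + a') * (g \<bullet> v)"
      using arg_cong[OF v, of "\<lambda>u. g \<bullet> u"] by (simp add: inner_add_right)
    then have "A * (g \<bullet> (y - w)) + a' * (g \<bullet> (y - xs)) = (A + a') * (g \<bullet> s) + a' * (g \<bullet> (z - xs))"
      by (simp add: s_def inner_diff_right algebra_simps)
    then show ?thesis
      by (metis (no_types, lifting) distrib_left mult.assoc)
  qed
  moreover have "(norm (z - (\<gamma> * a') *\<^sub>R g - xs))\<^sup>2 / 2
      = (norm (z - xs))\<^sup>2 / 2 - \<gamma> * a' * (g \<bullet> (z - xs)) + (\<gamma> * a')\<^sup>2 * (norm g)\<^sup>2 / 2"
  proof -
    define u where "u = z - xs"
    have eq: "z - (\<gamma> * a') *\<^sub>R g - xs = u - (\<gamma> * a') *\<^sub>R g" by (simp add: u_def)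
    have "(norm (u - (\<gamma> * a') *\<^sub>R g))\<^sup>2
        = (norm u)\<^sup>2 - 2 * (\<gamma> * a') * (g \<bullet> u) + (\<gamma> * a')\<^sup>2 * (norm g)\<^sup>2"
      unfolding power2_norm_eq_inner
      by (simp only: inner_diff_left inner_diff_right inner_scaleR_left inner_scaleR_right
          inner_commute[of u g]) (simp add: power2_eq_square algebra_simps)
    then show ?thesis unfolding eq u_def[symmetric] by linarith
  qed
  moreover have "\<gamma> * (A + a') * (g \<bullet> s) + (\<gamma> * a')\<^sup>2 * (norm g)\<^sup>2 / 2
      \<le> - (3 / 8) * (\<eta> * (A + a') * (norm s)\<^sup>2)"
  proof -
    have ga: "\<tau> * (\<gamma> * a')\<^sup>2 = \<gamma> * (A + a')"
    proof -
      have "\<tau> * (\<gamma> * a')\<^sup>2 = \<gamma> * ((\<gamma> * \<tau>) * a'\<^sup>2)"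
        by (simp add: power2_eq_square)
      then show ?thesis unfolding \<gamma>01(2) a' .
    qed
    have "2 * \<tau> * (\<gamma> * (A + a') * (g \<bullet> s) + (\<gamma> * a')\<^sup>2 * (norm g)\<^sup>2 / 2
          + (3 / 8) * (\<eta> * (A + a') * (norm s)\<^sup>2))
        = \<gamma> * (A + a') * (2 * \<tau> * (g \<bullet> s)) + (\<tau> * (\<gamma> * a')\<^sup>2) * (norm g)\<^sup>2
          + \<gamma> * (A + a') * (3 / 4 * \<tau>\<^sup>2 * (norm s)\<^sup>2)"
      unfolding \<gamma>01(2)[symmetric] by (simp add: power2_eq_square algebra_simps)
    also have "\<dots> = \<gamma> * (A + a') * (2 * \<tau> * (g \<bullet> s) + (norm g)\<^sup>2 + 3 / 4 * \<tau>\<^sup>2 * (norm s)\<^sup>2)"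
      unfolding ga by (simp add: algebra_simps)
    also have "\<dots> \<le> 0"
      using ms \<gamma>01 A' by (intro mult_nonneg_nonpos) auto
    finally have "\<gamma> * (A + a') * (g \<bullet> s) + (\<gamma> * a')\<^sup>2 * (norm g)\<^sup>2 / 2
        + (3 / 8) * (\<eta> * (A + a') * (norm s)\<^sup>2) \<le> 0"
      using \<tau> by (simp add: mult_le_0_iff)
    then show ?thesis by simp
  qed
  moreover have "(A + \<gamma> * a') * (fw' - fs)
      \<le> A * (fw - fs) + \<gamma> * A * (fy - fw) + \<gamma> * a' * (fy - fs)"
    using avg by (simp add: algebra_simps)
  ultimately show ?thesis
    unfolding s_def by linarith
qed

lemma extra_weight_pos_eq:
  assumes "0 \<le> A" "0 < \<eta>"
  shows "0 < extra_weight A \<eta>" "\<eta> * (extra_weight A \<eta>)\<^sup>2 = A + extra_weight A \<eta>"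
proof -
  define r where "r = sqrt (1 + 4 * \<eta> * A)"
  have r: "0 \<le> r" "r * r = 1 + 4 * \<eta> * A" using assms by (auto simp: r_def)
  have a: "extra_weight A \<eta> = (1 + r) / (2 * \<eta>)" by (simp add: extra_weight_def r_def)
  show "0 < extra_weight A \<eta>" unfolding a using r assms by simp
  have "4 * \<eta> * (\<eta> * ((1 + r) / (2 * \<eta>))\<^sup>2) = 4 * \<eta> * (A + (1 + r) / (2 * \<eta>))"
    using assms r by (simp add: field_simps power2_eq_square)
  then show "\<eta> * (extra_weight A \<eta>)\<^sup>2 = A + extra_weight A \<eta>"
    unfolding a using assms by simp
qed

lemma powr_two_thirds_cubed:
  fixes x :: real
  assumes "0 \<le> x" shows "(x powr (2 / 3)) ^ 3 = x\<^sup>2"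
proof (cases "x = 0")
  case False
  then have x: "0 < x" using assms by simp
  have "(x powr (2 / 3)) ^ 3 = (x powr (2 / 3)) powr real 3"
    using x by (intro powr_realpow[symmetric]) simp
  also have "\<dots> = x powr real 2" by (simp add: powr_powr)
  also have "\<dots> = x\<^sup>2" using x by (rule powr_realpow)
  finally show ?thesis .
qed simp

lemma B_const_ge_1: "1 \<le> B_const M1 \<rho> R"
  by (simp add: B_const_def)

text \<open>
  The form in which \<open>B\<close> enters: \<open>R\<^sup>2 / B\<^sup>3\<close> is a lower bound, up to constants, for the squared length at which
  the gradient part of the smoothness constant or the radius can cause a rejection.
\<close>

lemma B_const_cubed_ge:
  assumes "0 \<le> M1" "0 \<le> R" "0 < \<rho>"
  shows "36 * M1 * R\<^sup>2 \<le> B_const M1 \<rho> R ^ 3"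
    and "\<rho> \<le> ereal r \<Longrightarrow> 4 * R\<^sup>2 \<le> r\<^sup>2 * B_const M1 \<rho> R ^ 3"
proof -
  have "36 * M1 * R\<^sup>2 = ((6 * sqrt M1 * R) powr (2 / 3)) ^ 3"
    using assms by (simp add: powr_two_thirds_cubed power_mult_distrib)
  also have "\<dots> \<le> B_const M1 \<rho> R ^ 3"
    by (intro power_mono) (auto simp: B_const_def)
  finally show "36 * M1 * R\<^sup>2 \<le> B_const M1 \<rho> R ^ 3" .
  assume le: "\<rho> \<le> ereal r"
  obtain q where q: "\<rho> = ereal q" "0 < q" "q \<le> r"
    using le assms(3) by (cases \<rho>) auto
  have "(2 * R / q)\<^sup>2 = (over_radius (2 * R) \<rho> powr (2 / 3)) ^ 3"
    using q assms by (simp add: powr_two_thirds_cubed over_radius_def)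
  also have "\<dots> \<le> B_const M1 \<rho> R ^ 3"
    by (intro power_mono) (auto simp: B_const_def)
  finally have "4 * R\<^sup>2 \<le> q\<^sup>2 * B_const M1 \<rho> R ^ 3"
    using q by (simp add: power_divide power_mult_distrib field_simps)
  also have "\<dots> \<le> r\<^sup>2 * B_const M1 \<rho> R ^ 3"
    using q B_const_ge_1[of M1 \<rho> R] by (intro mult_right_mono power_mono) auto
  finally show "4 * R\<^sup>2 \<le> r\<^sup>2 * B_const M1 \<rho> R ^ 3" .
qed

section \<open>Runs of the method\<close>

locale anpe_run = convex_smooth_problem +
  fixes x0 :: rvec and \<eta>0 :: real
  assumes x0: "x0 \<in> euclid d" and \<eta>0: "0 < \<eta>0"
begin

definition R :: real where "R = norm (x0 - xs)"
definition B :: real where "B = B_const M1 \<rho> R"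
text \<open>
  Up to the factor 4, a bound for the first accepted regularization, which is the reciprocal of the first
  weight.
\<close>

definition D :: real where "D = max \<eta>0 (tau_bar M0 M1 \<delta> \<rho> grad x0)"

text \<open>
  Energy, weight and regularization are only meaningful while the method is running; the value 0 at a
  returned state is a placeholder.
\<close>

fun energy :: "anpe_state \<Rightarrow> real" where
  "energy (Running w z A \<eta>) = A * (f w - f xs) + (norm (z - xs))\<^sup>2 / 2"
| "energy (Returned p) = 0"

fun weight :: "anpe_state \<Rightarrow> real" where
  "weight (Running w z A \<eta>) = A" | "weight (Returned p) = 0"

fun reg :: "anpe_state \<Rightarrow> real" where
  "reg (Running w z A \<eta>) = \<eta>" | "reg (Returned p) = 0"

fun running :: "anpe_state \<Rightarrow> bool" where
  "running (Running w z A \<eta>) = True" | "running (Returned p) = False"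

fun valid :: "anpe_state \<Rightarrow> bool" where
  "valid (Running w z A \<eta>) \<longleftrightarrow> w \<in> euclid d \<and> z \<in> euclid d \<and> 0 < A \<and> 0 < \<eta>"
| "valid (Returned p) \<longleftrightarrow> p \<in> euclid d \<and> grad p = 0"

abbreviation gap :: "anpe_state \<Rightarrow> real" where "gap X \<equiv> f (output_point X) - f xs"

lemma extrapolated_in: "w \<in> euclid d \<Longrightarrow> z \<in> euclid d \<Longrightarrow> extrapolated w z A \<eta> \<in> euclid d"
  unfolding extrapolated_def by (intro in_euclid_intros)

text \<open>
  Here \<open>A'\<close> may be any positive weight for which the energy drop is available; it is used with the
  weight after the step, which is below the undamped weight of the energy inequality.
\<close>

lemma damped_step_cost:
  assumes x: "x \<in> euclid d" and s: "step_at x \<tau> s" and \<eta>: "0 < \<eta>" "2 * \<eta> \<le> \<tau>"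
    and rej: "\<And>s'. step_at x (\<tau> / 2) s' \<Longrightarrow> \<not> ms_test grad x (\<tau> / 2) s'"
    and A': "0 < A'" and cost: "3 / 8 * (\<eta> * A' * (norm s)\<^sup>2) \<le> \<Delta>"
  shows "\<eta> \<le> 4 * \<delta> \<or> \<eta> * A' * R\<^sup>2 \<le> 30 * B ^ 3 * \<Delta> \<or> \<eta> ^ 3 * A' \<le> 4000 * M0\<^sup>2 * \<Delta>"
proof -
  let ?n = "norm s"
  have B3: "0 \<le> B ^ 3" using B_const_ge_1[of M1 \<rho> R] by (simp add: B_def)
  have R: "0 \<le> R" by (simp add: R_def)
  have long: "\<eta> * A' * R\<^sup>2 \<le> 30 * B ^ 3 * \<Delta>" if "R\<^sup>2 \<le> 4 * (B ^ 3 * ?n\<^sup>2)"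
  proof -
    have "\<eta> * A' * R\<^sup>2 \<le> \<eta> * A' * (4 * (B ^ 3 * ?n\<^sup>2))"
      using that \<eta> A' by (intro mult_left_mono) auto
    also have "\<dots> = 32 / 3 * (B ^ 3 * (3 / 8 * (\<eta> * A' * ?n\<^sup>2)))" by simp
    also have "\<dots> \<le> 32 / 3 * (B ^ 3 * \<Delta>)"
      using cost B3 by (intro mult_left_mono) auto
    also have "\<dots> \<le> 30 * (B ^ 3 * \<Delta>)"
    proof (rule mult_right_mono)
      have "0 \<le> \<Delta>" using cost \<eta> A' by (rule_tac order_trans[OF _ cost]) auto
      then show "0 \<le> B ^ 3 * \<Delta>" using B3 by simp
    qed simp
    finally show ?thesis by (simp add: mult.assoc)
  qed
  have "0 < \<tau>" using \<eta> by simp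
  from damped_step_long[OF x s this rej]
  consider "\<tau> \<le> 8 * \<delta>" | (r) "\<rho> < ereal (7 / 3 * ?n)" | (M1) "1 < 131 * M1 * ?n\<^sup>2"
    | (M0) "\<tau> < 75 * M0 * ?n"
    by blast
  then show ?thesis
  proof cases
    case 1
    then show ?thesis using \<eta> by simp
  next
    case r
    have "4 * R\<^sup>2 \<le> (7 / 3 * ?n)\<^sup>2 * B ^ 3"
      unfolding B_def using r by (intro B_const_cubed_ge M1_nonneg R \<rho>_pos) auto
    also have "\<dots> = 49 / 9 * (B ^ 3 * ?n\<^sup>2)" by (simp add: power2_eq_square)
    finally have "R\<^sup>2 \<le> 4 * (B ^ 3 * ?n\<^sup>2)"
      using mult_nonneg_nonneg[OF B3, of "?n\<^sup>2"] zero_le_power2[of ?n] by linarith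
    then show ?thesis using long by blast
  next
    case M1
    have "R\<^sup>2 * 1 \<le> R\<^sup>2 * (131 * M1 * ?n\<^sup>2)"
      using M1 by (intro mult_left_mono) auto
    also have "\<dots> = 131 / 36 * (36 * M1 * R\<^sup>2 * ?n\<^sup>2)" by simp
    also have "\<dots> \<le> 131 / 36 * (B ^ 3 * ?n\<^sup>2)"
      unfolding B_def using B_const_cubed_ge(1)[OF M1_nonneg R \<rho>_pos]
      by (intro mult_left_mono mult_right_mono) auto
    also have "\<dots> \<le> 4 * (B ^ 3 * ?n\<^sup>2)"
      using B3 by (intro mult_right_mono) auto
    finally show ?thesis using long by simp
  next
    case M0
    then have "\<eta> \<le> 38 * M0 * ?n" using \<eta> M0_nonneg mult_nonneg_nonneg[of M0 ?n] by simp
    then have "\<eta>\<^sup>2 \<le> (38 * M0 * ?n)\<^sup>2" using \<eta> by (intro power_mono) auto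
    then have "\<eta> * A' * \<eta>\<^sup>2 \<le> \<eta> * A' * (38 * M0 * ?n)\<^sup>2"
      using \<eta> A' by (intro mult_left_mono) auto
    also have "\<dots> = 11552 / 3 * M0\<^sup>2 * (3 / 8 * (\<eta> * A' * ?n\<^sup>2))"
      by (simp add: power_mult_distrib)
    also have "\<dots> \<le> 4000 * M0\<^sup>2 * \<Delta>"
      using cost \<eta> A' by (intro mult_mono) auto
    finally show ?thesis by (simp add: power3_eq_cube power2_eq_square mult_ac)
  qed
qed

lemma init_valid:
  assumes "anpe_init d grad H x0 \<eta>0 X"
  shows "valid X"
    and "running X \<Longrightarrow> grad x0 \<noteq> 0 \<and> weight X * reg X = 1 \<and> reg X \<le> 4 * D \<and> energy X \<le> R\<^sup>2 / 2"
proof -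
  have "valid X \<and> (running X \<longrightarrow>
      grad x0 \<noteq> 0 \<and> weight X * reg X = 1 \<and> reg X \<le> 4 * D \<and> energy X \<le> R\<^sup>2 / 2)"
    using assms
  proof cases
    case (1 p)
    then show ?thesis using backtrack_zero[OF 1(2) x0] by simp
  next
    case (2 w \<eta> A)
    from backtrack_accepted[OF 2(2) refl \<eta>0] obtain s where
      s: "grad x0 \<noteq> 0" "w = x0 + s" "step_at x0 \<eta> s" "ms_test grad x0 \<eta> s" and "\<eta>0 \<le> \<eta>"
      using \<eta>0 by auto
    then have \<eta>: "0 < \<eta>" using \<eta>0 by simp
    have w: "w \<in> euclid d" unfolding s(2) by (rule trial_in[OF x0 s(3)])
    \<comment> \<open>The first iteration is an undamped step from \<open>x0\<close> with zero initial weight.\<close>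
    have "(0 + 1 * (1 / \<eta>)) * (f w - f xs) + (norm (x0 - (1 * (1 / \<eta>)) *\<^sub>R grad w - xs))\<^sup>2 / 2
      \<le> 0 * (f w - f xs) + (norm (x0 - xs))\<^sup>2 / 2 - 3 / 8 * (\<eta> * (0 + 1 / \<eta>) * (norm (w - x0))\<^sup>2)"
      by (rule monteiro_svaiter_energy_decrease[where \<tau> = \<eta> and w = w and fy = "f w"])
        (use \<eta> s w convexity_above_tangent[OF w minimizer(1)] in
          \<open>auto simp: ms_test_def power2_eq_square\<close>)
    moreover have "0 \<le> \<eta> * (0 + 1 / \<eta>) * (norm (w - x0))\<^sup>2" using \<eta> by simp
    ultimately have "(0 + 1 * (1 / \<eta>)) * (f w - f xs) + (norm (x0 - (1 * (1 / \<eta>)) *\<^sub>R grad w - xs))\<^sup>2 / 2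
        \<le> R\<^sup>2 / 2"
      unfolding R_def by linarith
    then have "energy X \<le> R\<^sup>2 / 2"
      by (simp add: 2)
    moreover have "\<eta> \<le> 4 * D"
      unfolding D_def by (rule accepted_le_tau_bar[OF x0 2(2) \<eta>0])
    ultimately show ?thesis
      using \<eta> s(1) w x0 by (simp add: 2 grad_in in_euclid_intros)
  qed
  then show "valid X" "running X \<Longrightarrow>
      grad x0 \<noteq> 0 \<and> weight X * reg X = 1 \<and> reg X \<le> 4 * D \<and> energy X \<le> R\<^sup>2 / 2"
    by auto
qed

lemma step_valid:
  assumes "anpe_step d grad H X Y" "valid X"
  shows "valid Y"
    and "running Y \<Longrightarrow> running X \<and> weight X \<le> weight Y \<and> energy Y \<le> energy X \<and>
      ((reg Y = reg X / 2 \<and> (\<exists>a>0. weight Y = weight X + a \<and> reg X * a\<^sup>2 = weight X + a)) \<or>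
       (reg Y = 2 * reg X \<and> (reg X \<le> 4 * \<delta> \<or>
          reg X * weight Y * R\<^sup>2 \<le> 30 * B ^ 3 * (energy X - energy Y) \<or>
          reg X ^ 3 * weight Y \<le> 4000 * M0\<^sup>2 * (energy X - energy Y))))"
    (is "_ \<Longrightarrow> ?Q")
proof -
  have "valid Y \<and> (running Y \<longrightarrow> ?Q)"
    using assms(1)
  proof cases
    case (1 p)
    then show ?thesis using assms(2) by simp
  next
    case (2 w z A \<eta> p)
    then show ?thesis
      using backtrack_zero[OF 2(3) extrapolated_in] assms(2) by simp
  next
    case (3 w z A \<eta> y \<tau> a' A' \<gamma> a A_next w_next z_next \<eta>_next)
    let ?v = "extrapolated w z A \<eta>"
    have ok: "w \<in> euclid d" "z \<in> euclid d" "0 < A" "0 < \<eta>" using assms(2) 3 by auto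
    have v: "?v \<in> euclid d" using ok by (simp add: extrapolated_in)
    from backtrack_accepted[OF 3(3) refl ok(4)] obtain s where
      s: "y = ?v + s" "step_at ?v \<tau> s" "ms_test grad ?v \<tau> s" and
      \<tau>: "\<tau> = \<eta> \<or> 2 * \<eta> \<le> \<tau> \<and> (\<forall>s'. step_at ?v (\<tau> / 2) s' \<longrightarrow> \<not> ms_test grad ?v (\<tau> / 2) s')"
      by auto
    have y: "y \<in> euclid d" unfolding s(1) by (rule trial_in[OF v s(2)])
    have \<eta>\<tau>: "\<eta> \<le> \<tau>" using \<tau> ok by auto
    have a': "0 < a'" "\<eta> * a'\<^sup>2 = A + a'"
      using extra_weight_pos_eq[of A \<eta>] ok 3(4) by auto
    have \<gamma>: "0 < \<gamma>" "\<gamma> \<le> 1" using ok \<eta>\<tau> 3(6) by auto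
    have A_next: "A_next = A + \<gamma> * a'" "0 < A_next" using 3(7,8) ok a' \<gamma> by (auto intro: add_pos_pos)
    have w_next: "w_next = ((1 - \<gamma>) * A / A_next) *\<^sub>R w + (\<gamma> * A' / A_next) *\<^sub>R y"
      using 3(9) by (simp add: scaleR_add_right divide_inverse mult_ac)
    have one: "(1 - \<gamma>) * A / A_next + \<gamma> * A' / A_next = 1"
    proof -
      have "(1 - \<gamma>) * A + \<gamma> * A' = A_next" using A_next 3(5) by (simp add: algebra_simps)
      then show ?thesis
        using A_next(2) unfolding add_divide_distrib[symmetric] by simp
    qed
    have in_E: "w_next \<in> euclid d" "z_next \<in> euclid d"
      unfolding w_next 3(10)
      by (rule in_euclid_intros ok y grad_in)+
    have avg: "A_next * f w_next \<le> (1 - \<gamma>) * A * f w + \<gamma> * (A + a') * f y"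
    proof -
      let ?t = "\<gamma> * A' / A_next"
      have t: "0 \<le> ?t" "?t \<le> 1" "(1 - \<gamma>) * A / A_next = 1 - ?t"
      proof -
        have "0 \<le> (1 - \<gamma>) * A / A_next" "0 \<le> ?t"
          using \<gamma> ok a' A_next(2) 3(5) by simp_all
        then show "0 \<le> ?t" "?t \<le> 1" "(1 - \<gamma>) * A / A_next = 1 - ?t"
          using one by linarith+
      qed
      have "f w_next \<le> (1 - ?t) * f w + ?t * f y"
        unfolding w_next t(3) using t ok y by (intro convex_onD[OF convex_f]) auto
      then have "A_next * f w_next \<le> A_next * (((1 - \<gamma>) * A / A_next) * f w + ?t * f y)"
        using A_next(2) unfolding t(3) by (intro mult_left_mono) auto
      also have "\<dots> = (1 - \<gamma>) * A * f w + \<gamma> * A' * f y"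
        using A_next(2) by (simp add: distrib_left)
      finally show ?thesis unfolding 3(5) .
    qed
    have "(A + \<gamma> * a') * (f w_next - f xs) + (norm (z - (\<gamma> * a') *\<^sub>R grad y - xs))\<^sup>2 / 2
      \<le> A * (f w - f xs) + (norm (z - xs))\<^sup>2 / 2 - 3 / 8 * (\<eta> * (A + a') * (norm (y - ?v))\<^sup>2)"
    proof (rule monteiro_svaiter_energy_decrease[OF _ a'(1) ok(4) \<eta>\<tau> _ a'(2) 3(6)])
      show "(A + a') *\<^sub>R ?v = A *\<^sub>R w + a' *\<^sub>R z"
        using ok a' by (simp add: extrapolated_def flip: 3(4))
    qed (use ok s y avg A_next convexity_above_tangent[OF y] minimizer in \<open>auto simp: ms_test_def\<close>)
    then have dec: "3 / 8 * (\<eta> * A' * (norm s)\<^sup>2) \<le> energy X - energy Y"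
      by (simp add: 3(1,2,5,7,10) A_next s(1))
    have A'A: "0 < A_next" "A_next \<le> A'"
      using A_next 3(5) \<gamma> a' by (auto simp: mult_left_le_one_le)
    have dec': "3 / 8 * (\<eta> * A_next * (norm s)\<^sup>2) \<le> energy X - energy Y"
      using A'A ok by (intro order_trans[OF _ dec] mult_left_mono mult_right_mono) auto
    moreover have "0 \<le> 3 / 8 * (\<eta> * A_next * (norm s)\<^sup>2)" using A'A ok by simp
    ultimately have "energy Y \<le> energy X" by linarith
    moreover have "A \<le> A_next" using A_next \<gamma> a' by simp
    moreover have "(\<eta>_next = \<eta> / 2 \<and> (\<exists>a>0. A_next = A + a \<and> \<eta> * a\<^sup>2 = A + a)) \<or>
       (\<eta>_next = 2 * \<eta> \<and> (\<eta> \<le> 4 * \<delta> \<or> \<eta> * A_next * R\<^sup>2 \<le> 30 * B ^ 3 * (energy X - energy Y) \<or>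
          \<eta> ^ 3 * A_next \<le> 4000 * M0\<^sup>2 * (energy X - energy Y)))"
    proof (cases "\<tau> = \<eta>")
      case True
      then show ?thesis using a' A_next 3(6,11) ok by auto
    next
      case False
      then show ?thesis
        using damped_step_cost[OF v s(2) ok(4) _ _ A'A(1) dec'] \<tau> 3(11) by auto
    qed
    ultimately show ?thesis
      using in_E A_next(2) ok by (simp add: 3(1,2,11))
  qed
  then show "valid Y" "running Y \<Longrightarrow> ?Q" by auto
qed

lemma init_exists: "\<exists>X. anpe_init d grad H x0 \<eta>0 X"
proof -
  obtain r where r: "backtrack x0 \<eta>0 r" using backtrack_terminates[OF x0 \<eta>0] by blast
  show ?thesis
  proof (cases r)
    case (Zero_Grad p)
    then show ?thesis using r anpe_init.intros(1) by blast
  next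
    case (Accepted w \<eta>)
    then show ?thesis using r anpe_init.intros(2)[of d grad H x0 \<eta>0 w \<eta> "1 / \<eta>"] by blast
  qed
qed

lemma step_exists:
  assumes "valid X" shows "\<exists>Y. anpe_step d grad H X Y"
proof (cases X)
  case (Running w z A \<eta>)
  with assms obtain r where r: "backtrack (extrapolated w z A \<eta>) \<eta> r"
    using backtrack_terminates extrapolated_in by fastforce
  show ?thesis
  proof (cases r)
    case (Zero_Grad p)
    then show ?thesis using r Running anpe_step.intros(2) by blast
  next
    case (Accepted y \<tau>)
    then show ?thesis
      unfolding Running by (intro exI) (rule anpe_step.intros(3), use r in auto)
  qed
qed (auto intro: anpe_step.intros(1))

lemma outputs_exist: "\<exists>w. anpe_outputs d grad H x0 \<eta>0 w"
proof -
  obtain X0 where X0: "anpe_init d grad H x0 \<eta>0 X0" using init_exists by blast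
  define next_state where "next_state X = (SOME Y. anpe_step d grad H X Y)" for X
  define X where "X k = (next_state ^^ (k - 1)) X0" for k
  have step: "anpe_step d grad H X (next_state X)" if "valid X" for X
    unfolding next_state_def using step_exists[OF that] by (rule someI_ex)
  have Suc: "X (Suc k) = next_state (X k)" if "1 \<le> k" for k
    using that by (cases k) (auto simp: X_def)
  have "valid (X k)" if "1 \<le> k" for k
    using that
  proof (induction k rule: dec_induct)
    case base
    then show ?case using init_valid(1)[OF X0] by (simp add: X_def)
  next
    case (step k)
    then show ?case using Suc step_valid(1)[OF \<open>\<And>X. valid X \<Longrightarrow> anpe_step d grad H X (next_state X)\<close>] by simp
  qed
  then have "anpe_outputs d grad H x0 \<eta>0 (\<lambda>k. output_point (X k))"
    unfolding anpe_outputs_def using X0 step Suc by (intro exI[of _ X]) (auto simp: X_def)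
  then show ?thesis by blast
qed

end

section \<open>Convergence rates\<close>

context anpe_run begin

definition run :: "(nat \<Rightarrow> anpe_state) \<Rightarrow> bool" where
  "run X \<longleftrightarrow> anpe_init d grad H x0 \<eta>0 (X 1) \<and> (\<forall>k\<ge>1. anpe_step d grad H (X k) (X (Suc k)))"

lemma B_ge_1: "1 \<le> B" by (simp add: B_def B_const_ge_1)

lemma D_pos: "0 < D" using \<eta>0 by (simp add: D_def)

lemma R_nonneg: "0 \<le> R" by (simp add: R_def)

lemma R_pos: "grad x0 \<noteq> 0 \<Longrightarrow> 0 < R"
  using grad_minimizer by (auto simp: R_def)

lemma run_valid:
  assumes "run X" "1 \<le> k" shows "valid (X k)"
  using assms(2)
proof (induction k rule: dec_induct)
  case base
  then show ?case using init_valid(1) assms(1) by (simp add: run_def)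
next
  case (step k)
  then show ?case using step_valid(1)[of "X k"] assms(1) by (simp add: run_def)
qed

lemma running_earlier:
  assumes X: "run X" and T: "running (X T)" and k: "1 \<le> k" "k \<le> T"
  shows "running (X k)"
  using k(2) k(1)
proof (induction k rule: inc_induct)
  case (step k)
  then have "running (X (Suc k))" by simp
  moreover have "anpe_step d grad H (X k) (X (Suc k))" using X step by (simp add: run_def)
  ultimately show ?case using step_valid(2) run_valid[OF X] step by blast
qed (rule T)

lemma energy_nonneg: "valid X \<Longrightarrow> 0 \<le> energy X"
  using minimizer(2) by (cases X) (auto intro!: add_nonneg_nonneg mult_nonneg_nonneg)

lemma run_monotone:
  assumes X: "run X" and k: "1 \<le> k" and r: "running (X k)"
  shows "energy (X k) \<le> R\<^sup>2 / 2 \<and> weight (X 1) \<le> weight (X k)"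
  using k r
proof (induction k rule: dec_induct)
  case base
  then show ?case using init_valid(2) X by (auto simp: run_def)
next
  case (step k)
  have "anpe_step d grad H (X k) (X (Suc k))" using X step by (simp add: run_def)
  from step_valid(2)[OF this run_valid[OF X step(1)] step.prems] step.IH
  show ?case by force
qed

lemma gap_not_running: "valid X \<Longrightarrow> \<not> running X \<Longrightarrow> gap X = 0"
  by (cases X) (auto simp: grad_zero_imp_min)

lemma gap_running:
  assumes "valid X" "running X" "energy X \<le> R\<^sup>2 / 2"
  shows "0 < weight X" "2 * weight X * gap X \<le> R\<^sup>2"
proof -
  show "0 < weight X" using assms by (cases X) auto
  have "weight X * gap X \<le> energy X" using assms by (cases X) auto
  then show "2 * weight X * gap X \<le> R\<^sup>2" using assms(3) by simp
qed

lemma run_start: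
  assumes "run X" "running (X 1)"
  shows "0 < R" "0 < weight (X 1)" "weight (X 1) * reg (X 1) = 1" "reg (X 1) \<le> 4 * D"
  using assms init_valid[of "X 1"] R_pos run_valid[OF assms(1), of 1]
    gap_running(1)[of "X 1"] by (auto simp: run_def)

lemma running_length_le:
  assumes X: "run X" and T: "1 \<le> T" "running (X T)" and P: "B \<le> P"
    and small: "(M0 * R * weight (X T))\<^sup>2 \<le> P ^ 7" "\<delta> * weight (X T) \<le> P\<^sup>2"
  shows "real T \<le> 130000 * (P + B * ln (weight (X T) / weight (X 1)))"
proof -
  have running: "running (X k)" if "1 \<le> k" "k \<le> T" for k
    using running_earlier[OF X T(2) that] .
  have start: "0 < R" "weight (X 1) * reg (X 1) = 1"
    using run_start[OF X] running[of 1] T by auto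
  have pos: "0 < weight (X k) \<and> 0 < reg (X k)" if "1 \<le> k" "k \<le> T" for k
    using run_valid[OF X that(1)] running[OF that] by (cases "X k") auto
  interpret damped_weights "\<lambda>k. weight (X k)" "\<lambda>k. reg (X k)" "\<lambda>k. energy (X k) / R\<^sup>2" B \<delta> "M0 * R" P T
  proof unfold_locales
    fix k assume k: "1 \<le> k" "k < T"
    have st: "anpe_step d grad H (X k) (X (Suc k))" using X k by (simp add: run_def)
    have "running (X (Suc k))" using running k by simp
    note step = step_valid(2)[OF st run_valid[OF X k(1)] this]
    have scale: "u * R\<^sup>2 \<le> v * (energy (X k) - energy (X (Suc k))) \<Longrightarrow>
        u \<le> v * (energy (X k) / R\<^sup>2 - energy (X (Suc k)) / R\<^sup>2)" for u v
      using start(1) by (simp add: field_simps)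
    have "reg (X k) ^ 3 * weight (X (Suc k)) * R\<^sup>2
        \<le> 4000 * (M0 * R)\<^sup>2 * (energy (X k) - energy (X (Suc k)))"
      if "reg (X k) ^ 3 * weight (X (Suc k)) \<le> 4000 * M0\<^sup>2 * (energy (X k) - energy (X (Suc k)))"
      using mult_right_mono[OF that, of "R\<^sup>2"] by (simp add: power_mult_distrib mult_ac)
    then show "weight (X k) \<le> weight (X (Suc k)) \<and>
        energy (X (Suc k)) / R\<^sup>2 \<le> energy (X k) / R\<^sup>2 \<and>
        ((reg (X (Suc k)) = reg (X k) / 2 \<and>
            (\<exists>a>0. weight (X (Suc k)) = weight (X k) + a \<and> reg (X k) * a\<^sup>2 = weight (X k) + a)) \<or>
         (reg (X (Suc k)) = 2 * reg (X k) \<and> (reg (X k) \<le> 4 * \<delta> \<or>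
            reg (X k) * weight (X (Suc k)) \<le> 30 * B ^ 3 * (energy (X k) / R\<^sup>2 - energy (X (Suc k)) / R\<^sup>2) \<or>
            reg (X k) ^ 3 * weight (X (Suc k))
              \<le> 4000 * (M0 * R)\<^sup>2 * (energy (X k) / R\<^sup>2 - energy (X (Suc k)) / R\<^sup>2))))"
      using step scale by (auto intro: divide_right_mono)
  next
    show "energy (X 1) / R\<^sup>2 \<le> 1 / 2"
      using run_monotone[OF X _ running[of 1]] T(1) start(1) by (simp add: field_simps)
  next
    fix k assume "1 \<le> k" "k \<le> T"
    then show "0 \<le> energy (X k) / R\<^sup>2" using energy_nonneg run_valid[OF X] by simp
  qed (use B_ge_1 P T(1) \<delta>_nonneg pos start small in auto)
  show ?thesis by (rule length_bound)
qed

abbreviation transition :: real where "transition \<equiv> eps_tr M0 \<delta> R B"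

text \<open>
  A gap above \<open>\<epsilon>\<close> means \<open>A\<^sub>T < R\<^sup>2 / (2 \<epsilon>)\<close>, which gives the two smallness conditions of the growth estimate and
  a logarithm \<open>ln (2 D R\<^sup>2 / \<epsilon>)\<close>.  If \<open>\<epsilon>\<close> is below the transition accuracy, the logarithm may be
  stopped there, because the ratio of the two accuracies is at most \<open>48 (P/B)\<^bsup>7/2\<^esup>\<close> and
  \<open>B ln (P/B) \<le> P\<close>.
\<close>

lemma accuracy_iteration_bound:
  assumes X: "run X" and T: "1 \<le> T" and \<epsilon>: "0 < \<epsilon>" "\<epsilon> < gap (X T)" and P: "B \<le> P"
    and M0: "M0 * R ^ 3 \<le> \<epsilon> * P powr (7 / 2)" and \<delta>: "\<delta> * R\<^sup>2 \<le> \<epsilon> * P\<^sup>2"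
  shows "real T \<le> 7000000 * (P + B * log_plus (D * R\<^sup>2 / max \<epsilon> transition))"
proof -
  let ?W = "weight (X T)" and ?E = "max \<epsilon> transition"
  have run: "running (X T)" using gap_not_running[OF run_valid[OF X T]] \<epsilon> by fastforce
  then have run1: "running (X 1)" using running_earlier[OF X] T by blast
  note start = run_start[OF X run1]
  have W: "0 < ?W" "2 * ?W * gap (X T) \<le> R\<^sup>2"
    using gap_running[OF run_valid[OF X T] run] run_monotone[OF X T run] by auto
  have W\<epsilon>: "2 * (?W * \<epsilon>) \<le> R\<^sup>2"
  proof -
    have "2 * ?W * \<epsilon> \<le> 2 * ?W * gap (X T)" using \<epsilon> W by (intro mult_left_mono) auto
    then show ?thesis using W(2) by simp
  qed
  have W\<epsilon>': "?W * \<epsilon> \<le> R\<^sup>2" using W\<epsilon> W(1) \<epsilon>(1) mult_pos_pos[of ?W \<epsilon>] by linarith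
  have B1: "1 \<le> B" by (rule B_ge_1)
  have P1: "0 < P" "1 \<le> P / B" using P B1 by auto
  have small1: "(M0 * R * ?W)\<^sup>2 \<le> P ^ 7"
  proof -
    have "\<epsilon> * (M0 * R * ?W) = M0 * R * (?W * \<epsilon>)" by simp
    also have "\<dots> \<le> M0 * R * R\<^sup>2"
      using W\<epsilon>' M0_nonneg R_nonneg by (intro mult_left_mono) auto
    also have "\<dots> \<le> \<epsilon> * P powr (7 / 2)"
      using M0 by (simp add: power2_eq_square power3_eq_cube mult.assoc)
    finally have "M0 * R * ?W \<le> P powr (7 / 2)" using \<epsilon>(1) by simp
    then have "(M0 * R * ?W)\<^sup>2 \<le> (P powr (7 / 2))\<^sup>2"
      using M0_nonneg R_nonneg W by (intro power_mono) auto
    also have "\<dots> = P powr (7 / 2 + 7 / 2)"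
      unfolding power2_eq_square by (rule powr_add[symmetric])
    also have "\<dots> = P powr real 7" by simp
    also have "\<dots> = P ^ 7" using P1(1) by (rule powr_realpow)
    finally show ?thesis .
  qed
  have small2: "\<delta> * ?W \<le> P\<^sup>2"
  proof -
    have "\<epsilon> * (\<delta> * ?W) = \<delta> * (?W * \<epsilon>)" by simp
    also have "\<dots> \<le> \<delta> * R\<^sup>2" using W\<epsilon>' \<delta>_nonneg by (rule mult_left_mono)
    also have "\<dots> \<le> \<epsilon> * P\<^sup>2" by (rule \<delta>)
    finally show ?thesis using \<epsilon>(1) by simp
  qed
  have T_le: "real T \<le> 130000 * (P + B * ln (?W / weight (X 1)))"
    by (rule running_length_le[OF X T run P small1 small2])
  have E: "0 < ?E" using \<epsilon> by simp
  have DR: "0 < D * R\<^sup>2" using D_pos start(1) by simp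
  have "?W / weight (X 1) \<le> 2 * (D * R\<^sup>2) / \<epsilon>"
  proof -
    have "?W / weight (X 1) = ?W * reg (X 1)"
      using start(2,3) by (simp add: field_simps)
    also have "\<dots> \<le> ?W * (4 * D)"
      using start(4) W(1) by (intro mult_left_mono) auto
    also have "\<dots> \<le> 2 * (D * R\<^sup>2) / \<epsilon>"
      using mult_left_mono[OF W\<epsilon>, of D] D_pos \<epsilon>(1) by (simp add: field_simps)
    finally show ?thesis .
  qed
  then have "ln (?W / weight (X 1)) \<le> ln (2 * (D * R\<^sup>2) / \<epsilon>)"
    using W(1) start(2) by (intro ln_mono) auto
  also have "2 * (D * R\<^sup>2) / \<epsilon> = 2 * ((D * R\<^sup>2 / ?E) * (?E / \<epsilon>))"
    using E \<epsilon>(1) by simp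
  also have "ln \<dots> = ln 2 + (ln (D * R\<^sup>2 / ?E) + ln (?E / \<epsilon>))"
  proof -
    have pos: "0 < D * R\<^sup>2 / ?E" "0 < ?E / \<epsilon>" using E \<epsilon>(1) DR by simp_all
    then have "ln ((D * R\<^sup>2 / ?E) * (?E / \<epsilon>)) = ln (D * R\<^sup>2 / ?E) + ln (?E / \<epsilon>)"
      by (rule ln_mult_pos)
    moreover have "ln (2 * ((D * R\<^sup>2 / ?E) * (?E / \<epsilon>))) = ln 2 + ln ((D * R\<^sup>2 / ?E) * (?E / \<epsilon>))"
      by (rule ln_mult_pos) (use pos in \<open>auto intro: mult_pos_pos simp del: times_divide_eq_left times_divide_eq_right\<close>)
    ultimately show ?thesis by (simp only:)
  qed
  also have "\<dots> \<le> 1 + (log_plus (D * R\<^sup>2 / ?E) + (47 + 7 / 2 * (P / B)))"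
  proof (intro add_mono)
    show "ln (2::real) \<le> 1" using ln_le_minus_one[of "2::real"] by simp
    show "ln (D * R\<^sup>2 / ?E) \<le> log_plus (D * R\<^sup>2 / ?E)"
      using divide_pos_pos[OF DR E] unfolding log_plus_def by (simp only: not_le if_False max.cobounded2 flip: not_le)
    have ratio: "?E \<le> \<epsilon> * (48 * (P / B) powr (7 / 2))"
    proof -
      have p1: "1 \<le> (P / B) powr (7 / 2)" using P1 by (intro ge_one_powr_ge_zero) auto
      have "48 * M0 * R ^ 3 / B powr (7 / 2) \<le> 48 * (\<epsilon> * P powr (7 / 2)) / B powr (7 / 2)"
        using M0 by (intro divide_right_mono) auto
      also have "\<dots> = \<epsilon> * (48 * (P / B) powr (7 / 2))"
        using P1(1) B1 by (simp add: powr_divide)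
      finally have 1: "48 * M0 * R ^ 3 / B powr (7 / 2) \<le> \<epsilon> * (48 * (P / B) powr (7 / 2))" .
      have "16 * \<delta> * R\<^sup>2 / B\<^sup>2 \<le> 16 * (\<epsilon> * P\<^sup>2) / B\<^sup>2"
        using \<delta> by (intro divide_right_mono) auto
      also have "\<dots> = \<epsilon> * (16 * (P / B)\<^sup>2)" by (simp add: power_divide)
      also have "\<dots> \<le> \<epsilon> * (48 * (P / B) powr (7 / 2))"
      proof (intro mult_left_mono mult_mono)
        have "(P / B)\<^sup>2 = (P / B) powr real 2" using P1 B1 by (intro powr_realpow[symmetric]) auto
        also have "\<dots> \<le> (P / B) powr (7 / 2)" using P1 by (intro powr_mono) auto
        finally show "(P / B)\<^sup>2 \<le> (P / B) powr (7 / 2)" .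
      qed (use \<epsilon> in auto)
      finally have 2: "16 * \<delta> * R\<^sup>2 / B\<^sup>2 \<le> \<epsilon> * (48 * (P / B) powr (7 / 2))" .
      have "\<epsilon> * 1 \<le> \<epsilon> * (48 * (P / B) powr (7 / 2))"
        using p1 \<epsilon> by (intro mult_left_mono) auto
      with 1 2 show ?thesis by (simp add: eps_tr_def)
    qed
    then have "ln (?E / \<epsilon>) \<le> ln (48 * (P / B) powr (7 / 2))"
      using E \<epsilon>(1) by (intro ln_mono) (auto simp: divide_le_eq mult_ac)
    also have "\<dots> = ln 48 + 7 / 2 * ln (P / B)"
      using P1 B1 by (simp add: ln_mult ln_powr)
    also have "\<dots> \<le> 47 + 7 / 2 * (P / B)"
      using ln_le_minus_one[of 48] ln_le_minus_one[of "P / B"] P1 by simp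
    finally show "ln (?E / \<epsilon>) \<le> 47 + 7 / 2 * (P / B)" .
  qed
  finally have "B * ln (?W / weight (X 1)) \<le> B * (48 + log_plus (D * R\<^sup>2 / ?E) + 7 / 2 * (P / B))"
    using B1 by (intro mult_left_mono) auto
  also have "\<dots> = 48 * B + B * log_plus (D * R\<^sup>2 / ?E) + 7 / 2 * P"
    using B1 by (simp add: distrib_left)
  also have "\<dots> \<le> 52 * P + B * log_plus (D * R\<^sup>2 / ?E)"
    using P P1(1) by linarith
  finally have "B * ln (?W / weight (X 1)) \<le> 52 * P + B * log_plus (D * R\<^sup>2 / ?E)" .
  moreover have "0 \<le> B * log_plus (D * R\<^sup>2 / ?E)"
    using B1 by (simp add: log_plus_def)
  ultimately show ?thesis using T_le P1(1) by (simp add: distrib_left)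
qed

lemma log_plus_nonneg: "0 \<le> log_plus t" by (simp add: log_plus_def)

lemma log_plus_mono: "s \<le> t \<Longrightarrow> log_plus s \<le> log_plus t"
  by (auto simp: log_plus_def max.coboundedI2)

text \<open>
  With \<open>P = B + p + q\<close>, where \<open>p\<close> and \<open>q\<close> are the last two terms of the claimed count, both conditions of the
  iteration bound hold, so the first index beyond that bound cannot have a gap above \<open>\<epsilon>\<close>.
\<close>

lemma accuracy_reached:
  assumes X: "run X" and \<epsilon>: "0 < \<epsilon>"
  shows "\<exists>N\<ge>1. gap (X N) \<le> \<epsilon> \<and>
    real N \<le> 7000001 * (B * (1 + log_plus (D * R\<^sup>2 / max \<epsilon> transition))
      + (M0 * R ^ 3 / \<epsilon>) powr (2 / 7) + sqrt (\<delta> * R\<^sup>2 / \<epsilon>))"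
proof -
  define l where "l = log_plus (D * R\<^sup>2 / max \<epsilon> transition)"
  define p where "p = (M0 * R ^ 3 / \<epsilon>) powr (2 / 7)"
  define q where "q = sqrt (\<delta> * R\<^sup>2 / \<epsilon>)"
  define Q where "Q = B * (1 + l) + p + q"
  define N where "N = Suc (nat \<lfloor>7000000 * Q\<rfloor>)"
  have nonneg: "0 \<le> l" "0 \<le> p" "0 \<le> q"
    using \<delta>_nonneg \<epsilon> by (auto simp: l_def p_def q_def log_plus_nonneg)
  have "1 * 1 \<le> B * (1 + l)" using B_ge_1 nonneg by (intro mult_mono) auto
  then have Q: "1 \<le> Q" using nonneg by (simp add: Q_def)
  have N: "7000000 * Q < real N" "real N \<le> 7000001 * Q"
    using Q unfolding N_def by (simp_all add: of_nat_nat) linarith+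
  have "gap (X N) \<le> \<epsilon>"
  proof (rule ccontr)
    assume "\<not> gap (X N) \<le> \<epsilon>"
    then have "\<epsilon> < gap (X N)" by simp
    have "real N \<le> 7000000 * ((B + p + q) + B * log_plus (D * R\<^sup>2 / max \<epsilon> transition))"
    proof (rule accuracy_iteration_bound[OF X _ \<epsilon> \<open>\<epsilon> < gap (X N)\<close>])
      have "M0 * R ^ 3 / \<epsilon> = p powr (7 / 2)"
        using M0_nonneg R_nonneg \<epsilon> by (simp add: p_def powr_powr)
      also have "\<dots> \<le> (B + p + q) powr (7 / 2)"
        using nonneg B_ge_1 by (intro powr_mono2) auto
      finally show "M0 * R ^ 3 \<le> \<epsilon> * (B + p + q) powr (7 / 2)"
        using \<epsilon> by (simp add: divide_le_eq mult.commute)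
      have "\<delta> * R\<^sup>2 / \<epsilon> = q\<^sup>2"
        using \<delta>_nonneg \<epsilon> by (simp add: q_def)
      also have "\<dots> \<le> (B + p + q)\<^sup>2"
        using nonneg B_ge_1 by (intro power_mono) auto
      finally show "\<delta> * R\<^sup>2 \<le> \<epsilon> * (B + p + q)\<^sup>2"
        using \<epsilon> by (simp add: divide_le_eq mult.commute)
    qed (use nonneg N_def in auto)
    also have "\<dots> = 7000000 * Q" by (simp add: Q_def l_def algebra_simps)
    finally show False using N by simp
  qed
  then show ?thesis
    using N(2) unfolding Q_def l_def p_def q_def by (intro exI[of _ N]) (auto simp: N_def)
qed

text \<open>
  The weights only grow, so the bound from the first weight \<open>1 / \<eta>\<^sub>1 \<ge> 1 / (4 D)\<close> persists.
\<close>

lemma gap_le_initial: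
  assumes X: "run X" and k: "1 \<le> k"
  shows "gap (X k) \<le> 2 * (D * R\<^sup>2)"
proof (cases "running (X k)")
  case True
  then have "running (X 1)" using running_earlier[OF X] k by blast
  note start = run_start[OF X this]
  have m: "energy (X k) \<le> R\<^sup>2 / 2" "weight (X 1) \<le> weight (X k)"
    using run_monotone[OF X k True] by auto
  note g = gap_running[OF run_valid[OF X k] True m(1)]
  have "0 \<le> gap (X k)"
    using run_valid[OF X k] minimizer(2) by (cases "X k") auto
  then have "2 * (weight (X 1) * gap (X k)) \<le> 2 * weight (X k) * gap (X k)"
    using m(2) by (simp add: mult_right_mono)
  also have "\<dots> \<le> R\<^sup>2" by (rule g)
  finally have le: "2 * (weight (X 1) * gap (X k)) \<le> R\<^sup>2" .
  have "2 * gap (X k) = 2 * ((weight (X 1) * reg (X 1)) * gap (X k))"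
    unfolding start(3) by simp
  also have "\<dots> = reg (X 1) * (2 * (weight (X 1) * gap (X k)))"
    by (simp only: mult_ac)
  also have "\<dots> \<le> (4 * D) * R\<^sup>2"
    using le start D_pos by (intro mult_mono) (auto intro!: mult_nonneg_nonneg \<open>0 \<le> gap (X k)\<close>)
  also have "\<dots> = 2 * (2 * (D * R\<^sup>2))"
    by simp
  finally show ?thesis by (rule mult_left_le_imp_le) simp
next
  case False
  then show ?thesis using gap_not_running[OF run_valid[OF X k]] D_pos by simp
qed

text \<open>
  With the exponent \<open>t\<close> proportional to \<open>(k - 1) / B\<close>: for \<open>t \<le> 1\<close> the claim is the bound by the first weight.  For
  \<open>t > 1\<close> the claimed accuracy is still above the transition accuracy, so the iteration bound with \<open>P = B\<close> gives
  \<open>k = O(B t)\<close>, with a constant that is smaller than the one hidden in \<open>t\<close>.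
\<close>

lemma linear_phase:
  assumes X: "run X" and k: "1 \<le> k"
    and before: "0 < transition \<Longrightarrow>
      real k - 1 \<le> 14000001 * (B * max 1 (ln (D * R\<^sup>2 / transition)))"
  shows "gap (X k) \<le> 6 * (D * R\<^sup>2) * exp (- (1 / 28000002 * (real k - 1) / B))"
proof (rule ccontr)
  define t where "t = 1 / 28000002 * (real k - 1) / B"
  define \<epsilon> where "\<epsilon> = 6 * (D * R\<^sup>2) * exp (- t)"
  assume "\<not> ?thesis"
  then have gap: "\<epsilon> < gap (X k)" by (simp add: \<epsilon>_def t_def)
  have run: "running (X k)"
  proof (rule ccontr)
    assume "\<not> running (X k)"
    moreover have "0 \<le> \<epsilon>" using D_pos by (simp add: \<epsilon>_def)
    ultimately show False using gap gap_not_running[OF run_valid[OF X k]] by simp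
  qed
  then have "0 < R" using run_start(1)[OF X] running_earlier[OF X run] k by blast
  then have DR: "0 < D * R\<^sup>2" using D_pos by simp
  then have \<epsilon>: "0 < \<epsilon>" by (simp add: \<epsilon>_def)
  \<comment> \<open>The constant is \<open>2 * 14000001\<close>: it turns the hypothesis into \<open>2 t \<le> max 1 (ln _)\<close>, and it
    exceeds twice the constant 7000000 of the iteration bound, as the final contradiction requires.\<close>
  have kt: "real k - 1 = 28000002 * (B * t)" using B_ge_1 by (simp add: t_def)
  have t: "1 < t"
  proof (rule ccontr)
    assume "\<not> 1 < t"
    then have "exp (-1) \<le> exp (- t)" by simp
    moreover have "1 / 3 \<le> exp (-1 :: real)"
      using e_less_272 by (simp add: exp_minus field_simps)
    ultimately have "1 / 3 \<le> exp (- t)" by (rule order_trans[rotated])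
    then have "6 * (D * R\<^sup>2) * (1 / 3) \<le> \<epsilon>"
      unfolding \<epsilon>_def using DR by (intro mult_left_mono) auto
    then show False using gap gap_le_initial[OF X k] by linarith
  qed
  have tr: "transition \<le> \<epsilon>"
  proof (cases "0 < transition")
    case True
    let ?l = "ln (D * R\<^sup>2 / transition)"
    have "B * (2 * t) \<le> B * max 1 ?l" using before[OF True] unfolding kt by (simp add: mult.commute mult.left_commute)
    then have "2 * t \<le> max 1 ?l" using B_ge_1 by simp
    then have "t \<le> ?l" using t by (auto simp: max_def split: if_splits)
    then have "exp (- ?l) \<le> exp (- t)" by simp
    moreover have "exp (- ?l) = transition / (D * R\<^sup>2)"
      using True DR by (simp add: exp_minus)
    ultimately have "6 * (D * R\<^sup>2) * (transition / (D * R\<^sup>2)) \<le> \<epsilon>"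
      unfolding \<epsilon>_def using DR by (intro mult_left_mono) auto
    moreover have "6 * u * (v / u) = 6 * v" if "0 < u" for u v :: real
      using that by simp
    note this[OF DR, of transition]
    ultimately show ?thesis using True by linarith
  qed (use \<epsilon> in linarith)
  have "real k \<le> 7000000 * (B + B * log_plus (D * R\<^sup>2 / max \<epsilon> transition))"
  proof (rule accuracy_iteration_bound[OF X k \<epsilon> gap order_refl])
    have "48 * M0 * R ^ 3 / B powr (7 / 2) \<le> \<epsilon>" using tr by (simp add: eps_tr_def)
    then have "48 * (M0 * R ^ 3) \<le> \<epsilon> * B powr (7 / 2)"
      using B_ge_1 by (simp add: divide_le_eq mult.assoc)
    moreover have "0 \<le> M0 * R ^ 3" using M0_nonneg R_nonneg by simp
    ultimately show "M0 * R ^ 3 \<le> \<epsilon> * B powr (7 / 2)" by linarith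
    have "16 * \<delta> * R\<^sup>2 / B\<^sup>2 \<le> \<epsilon>" using tr by (simp add: eps_tr_def)
    then have "16 * (\<delta> * R\<^sup>2) \<le> \<epsilon> * B\<^sup>2"
      using B_ge_1 by (simp add: divide_le_eq mult.assoc)
    moreover have "0 \<le> \<delta> * R\<^sup>2" using \<delta>_nonneg by simp
    ultimately show "\<delta> * R\<^sup>2 \<le> \<epsilon> * B\<^sup>2" by linarith
  qed
  also have "max \<epsilon> transition = \<epsilon>" using tr by simp
  also have "log_plus (D * R\<^sup>2 / \<epsilon>) \<le> t"
  proof -
    have "u / (6 * u * exp (- t)) = exp t / 6" if "0 < u" for u :: real
      using that by (simp add: exp_minus field_simps)
    from this[OF DR] have "D * R\<^sup>2 / \<epsilon> = exp t / 6" unfolding \<epsilon>_def .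
    then have "ln (D * R\<^sup>2 / \<epsilon>) = t - ln 6"
      by (simp only:) (simp add: ln_div)
    moreover have "0 \<le> ln (6::real)" by simp
    ultimately show ?thesis using t by (simp add: log_plus_def)
  qed
  finally have "real k \<le> 7000000 * (B + B * t)" using B_ge_1 by simp
  also have "\<dots> \<le> 14000000 * (B * t)" using t B_ge_1 by simp
  also have "\<dots> \<le> real k - 1" unfolding kt using t B_ge_1 by simp
  finally show False by simp
qed

text \<open>
  Taking \<open>P = B + n / 14000000\<close> lets the iteration bound charge only \<open>n / 2\<close> for \<open>P - B\<close>; all the rest is
  already exceeded by \<open>m\<close>.  The price is the fourth power of the constant, which bounds
  \<open>((B + n) / P)\<^bsup>7/2\<^esup>\<close>.
\<close>

lemma sublinear_phase:
  assumes X: "run X" and tr: "0 < transition"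
    and m: "7000000 * (B * (1 + log_plus (D * R\<^sup>2 / transition))) < real m"
  shows "gap (X (m + n)) \<le> 14000000 ^ 4 *
    (M0 * R ^ 3 / (B + real n) powr (7 / 2) + \<delta> * R\<^sup>2 / (B + real n)\<^sup>2)"
proof (rule ccontr)
  let ?S = "B + real n"
  define \<epsilon> where "\<epsilon> = 14000000 ^ 4 * (M0 * R ^ 3 / ?S powr (7 / 2) + \<delta> * R\<^sup>2 / ?S\<^sup>2)"
  assume "\<not> ?thesis"
  then have gap: "\<epsilon> < gap (X (m + n))" by (simp add: \<epsilon>_def)
  have S: "0 < ?S" using B_ge_1 by simp
  have n1: "0 \<le> M0 * R ^ 3" "0 \<le> \<delta> * R\<^sup>2" using M0_nonneg R_nonneg \<delta>_nonneg by auto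
  have "0 < M0 * R ^ 3 \<or> 0 < \<delta> * R\<^sup>2"
  proof (rule ccontr)
    assume "\<not> ?thesis"
    then have "48 * M0 * R ^ 3 = 0" "16 * \<delta> * R\<^sup>2 = 0" using n1 by linarith+
    then have "transition = 0" unfolding eps_tr_def by (simp only: div_0 max.idem)
    then show False using tr by simp
  qed
  then have \<epsilon>: "0 < \<epsilon>"
    unfolding \<epsilon>_def using n1 S
    by (intro mult_pos_pos) (auto intro: add_pos_nonneg add_nonneg_pos)
  define P where "P = B + real n / 14000000"
  have P: "B \<le> P" "0 < P" "?S \<le> 14000000 * P" using B_ge_1 by (auto simp: P_def)
  have M0_le: "M0 * R ^ 3 \<le> \<epsilon> * P powr (7 / 2)"
  proof -
    have "?S powr (7 / 2) \<le> (14000000 * P) powr (7 / 2)" using S P by (intro powr_mono2) auto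
    also have "\<dots> = 14000000 powr (7 / 2) * P powr (7 / 2)" using P by (simp add: powr_mult)
    also have "\<dots> \<le> 14000000 powr real 4 * P powr (7 / 2)"
      by (intro mult_right_mono powr_mono) auto
    also have "14000000 powr real 4 = (14000000::real) ^ 4" by (rule powr_realpow) simp
    finally have *: "?S powr (7 / 2) \<le> 14000000 ^ 4 * P powr (7 / 2)" .
    have "M0 * R ^ 3 = M0 * R ^ 3 / ?S powr (7 / 2) * ?S powr (7 / 2)" using S by simp
    also have "\<dots> \<le> M0 * R ^ 3 / ?S powr (7 / 2) * (14000000 ^ 4 * P powr (7 / 2))"
      using * n1 S by (intro mult_left_mono) auto
    also have "\<dots> = 14000000 ^ 4 * (M0 * R ^ 3 / ?S powr (7 / 2)) * P powr (7 / 2)" by simp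
    also have "\<dots> \<le> \<epsilon> * P powr (7 / 2)"
      unfolding \<epsilon>_def using n1 by (intro mult_right_mono mult_left_mono) auto
    finally show ?thesis .
  qed
  have \<delta>_le: "\<delta> * R\<^sup>2 \<le> \<epsilon> * P\<^sup>2"
  proof -
    have "?S\<^sup>2 \<le> (14000000 * P)\<^sup>2" using S P by (intro power_mono) auto
    also have "\<dots> = 14000000\<^sup>2 * P\<^sup>2" by (rule power_mult_distrib)
    also have "\<dots> \<le> 14000000 ^ 4 * P\<^sup>2" by (intro mult_right_mono) auto
    finally have *: "?S\<^sup>2 \<le> 14000000 ^ 4 * P\<^sup>2" .
    have "\<delta> * R\<^sup>2 = \<delta> * R\<^sup>2 / ?S\<^sup>2 * ?S\<^sup>2" using S by simp
    also have "\<dots> \<le> \<delta> * R\<^sup>2 / ?S\<^sup>2 * (14000000 ^ 4 * P\<^sup>2)"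
      using * n1 S by (intro mult_left_mono) auto
    also have "\<dots> = 14000000 ^ 4 * (\<delta> * R\<^sup>2 / ?S\<^sup>2) * P\<^sup>2" by simp
    also have "\<dots> \<le> \<epsilon> * P\<^sup>2"
      unfolding \<epsilon>_def using n1 by (intro mult_right_mono mult_left_mono) auto
    finally show ?thesis .
  qed
  have m_pos: "1 \<le> m + n"
  proof -
    have "0 < 7000000 * (B * (1 + log_plus (D * R\<^sup>2 / transition)))"
      using B_ge_1 log_plus_nonneg[of "D * R\<^sup>2 / transition"] by simp
    then have "0 < real m" using m by linarith
    then show ?thesis by simp
  qed
  have "real (m + n) \<le> 7000000 * (P + B * log_plus (D * R\<^sup>2 / max \<epsilon> transition))"
    by (rule accuracy_iteration_bound[OF X m_pos \<epsilon> gap P(1) M0_le \<delta>_le])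
  also have "\<dots> \<le> 7000000 * (P + B * log_plus (D * R\<^sup>2 / transition))"
    using tr B_ge_1 D_pos
    by (intro mult_left_mono add_left_mono log_plus_mono divide_left_mono) auto
  also have "\<dots> = 7000000 * (B * (1 + log_plus (D * R\<^sup>2 / transition))) + real n / 2"
    by (simp add: P_def algebra_simps)
  also have "\<dots> < real m + real n / 2" using m by simp
  finally show False by simp
qed

end

theorem theorem4p1:
  shows "\<exists>C c :: real. C > 0 \<and> c > 0 \<and>
    (\<forall>(d::nat) (f :: rvec \<Rightarrow> real) (grad :: rvec \<Rightarrow> rvec) (hess :: rvec \<Rightarrow> rvec \<Rightarrow>\<^sub>L rvec)
      (H :: rvec \<Rightarrow> rvec \<Rightarrow>\<^sub>L rvec) (M0::real) (M1::real) (\<rho>::ereal) (\<delta>::real)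
      (xs::rvec) (x0::rvec) (\<eta>0::real) (R::real) (B::real) (\<epsilon>tr::real) (\<tau>0::real).
      convex_on (euclid d) f \<longrightarrow>
      twice_cont_diff d f grad hess \<longrightarrow>
      xs \<in> euclid d \<longrightarrow> (\<forall>x\<in>euclid d. f xs \<le> f x) \<longrightarrow>
      (\<forall>x\<in>euclid d. H x \<in> matrices d \<and> symmetric_mat (H x) \<and> norm (H x - hess x) \<le> \<delta>) \<longrightarrow>
      0 \<le> M0 \<longrightarrow> 0 \<le> M1 \<longrightarrow> 0 < \<rho> \<longrightarrow> gen_hess_smooth d grad hess M0 M1 \<rho> \<longrightarrow>
      x0 \<in> euclid d \<longrightarrow> 0 < \<eta>0 \<longrightarrow>
      R = norm (x0 - xs) \<longrightarrow>
      B = B_const M1 \<rho> R \<longrightarrow>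
      \<epsilon>tr = eps_tr M0 \<delta> R B \<longrightarrow>
      \<tau>0 = tau_bar M0 M1 \<delta> \<rho> grad x0 \<longrightarrow>
      (\<exists>w. anpe_outputs d grad H x0 \<eta>0 w) \<and>
      (\<forall>w. anpe_outputs d grad H x0 \<eta>0 w \<longrightarrow>
        (\<forall>\<epsilon>>0. \<exists>N\<ge>1. f (w N) - f xs \<le> \<epsilon> \<and>
           real N \<le> C * (B * (1 + log_plus (max \<eta>0 \<tau>0 * R^2 / max \<epsilon> \<epsilon>tr))
                         + (M0 * R^3 / \<epsilon>) powr (2/7) + sqrt (\<delta> * R^2 / \<epsilon>))) \<and>
        (\<exists>K::enat. 1 \<le> K \<and>
           (\<epsilon>tr > 0 \<longrightarrow>
              (\<exists>m. K = enat m \<and> real m \<le> C * B * max 1 (ln (max \<eta>0 \<tau>0 * R^2 / \<epsilon>tr)))) \<and>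
           (\<forall>k\<ge>1. enat k < K \<longrightarrow>
              f (w k) - f xs \<le> C * max \<eta>0 \<tau>0 * R^2 * exp (- (c * (real k - 1) / B))) \<and>
           (\<forall>m. K = enat m \<longrightarrow> (\<forall>n.
              f (w (m + n)) - f xs
                \<le> C * (M0 * R^3 / (B + real n) powr (7/2) + \<delta> * R^2 / (B + real n)^2))))))"
proof -
  \<comment> \<open>\<open>?C\<close> is the constant of the sublinear phase, which dominates all the others.\<close>
  let ?C = "14000000 ^ 4 :: real" and ?c = "1 / 28000002 :: real"
  have universal: "(\<exists>w. anpe_outputs d grad H x0 \<eta>0 w) \<and>
      (\<forall>w. anpe_outputs d grad H x0 \<eta>0 w \<longrightarrow>
        (\<forall>\<epsilon>>0. \<exists>N\<ge>1. f (w N) - f xs \<le> \<epsilon> \<and>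
           real N \<le> ?C * (B * (1 + log_plus (max \<eta>0 \<tau>0 * R^2 / max \<epsilon> \<epsilon>tr))
                         + (M0 * R^3 / \<epsilon>) powr (2/7) + sqrt (\<delta> * R^2 / \<epsilon>))) \<and>
        (\<exists>K::enat. 1 \<le> K \<and>
           (\<epsilon>tr > 0 \<longrightarrow>
              (\<exists>m. K = enat m \<and> real m \<le> ?C * B * max 1 (ln (max \<eta>0 \<tau>0 * R^2 / \<epsilon>tr)))) \<and>
           (\<forall>k\<ge>1. enat k < K \<longrightarrow>
              f (w k) - f xs \<le> ?C * max \<eta>0 \<tau>0 * R^2 * exp (- (?c * (real k - 1) / B))) \<and>
           (\<forall>m. K = enat m \<longrightarrow> (\<forall>n.
              f (w (m + n)) - f xs
                \<le> ?C * (M0 * R^3 / (B + real n) powr (7/2) + \<delta> * R^2 / (B + real n)^2)))))"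
    if problem: "convex_on (euclid d) f" "twice_cont_diff d f grad hess" "xs \<in> euclid d"
      "\<forall>x\<in>euclid d. f xs \<le> f x"
      "\<forall>x\<in>euclid d. H x \<in> matrices d \<and> symmetric_mat (H x) \<and> norm (H x - hess x) \<le> \<delta>"
      "0 \<le> M0" "0 \<le> M1" "0 < \<rho>" "gen_hess_smooth d grad hess M0 M1 \<rho>" "x0 \<in> euclid d" "0 < \<eta>0"
      and quantities: "R = norm (x0 - xs)" "B = B_const M1 \<rho> R" "\<epsilon>tr = eps_tr M0 \<delta> R B"
        "\<tau>0 = tau_bar M0 M1 \<delta> \<rho> grad x0"
    for d :: nat and f :: "rvec \<Rightarrow> real" and grad :: "rvec \<Rightarrow> rvec"
      and hess H :: "rvec \<Rightarrow> rvec \<Rightarrow>\<^sub>L rvec" and M0 M1 :: real and \<rho> :: ereal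
      and \<delta> :: real and xs x0 :: rvec and \<eta>0 R B \<epsilon>tr \<tau>0 :: real
  proof -
    interpret anpe_run d f grad hess H M0 M1 \<rho> \<delta> xs x0 \<eta>0
      by unfold_locales (use problem in auto)
    note eqs = R_def[folded quantities(1)] B_def[unfolded R_def, folded quantities(1), folded quantities(2)]
      D_def[folded quantities(4)]
    note accuracy = accuracy_reached[unfolded eqs, folded quantities(3)]
      and linear = linear_phase[unfolded eqs, folded quantities(3)]
      and sublinear = sublinear_phase[unfolded eqs, folded quantities(3)]
    have B1: "1 \<le> B" using B_ge_1 by (simp add: eqs)
    have D: "0 < max \<eta>0 \<tau>0" using \<open>0 < \<eta>0\<close> by simp
    let ?DR = "max \<eta>0 \<tau>0 * R\<^sup>2"
    show ?thesis
    proof (intro conjI allI impI)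
      show "\<exists>w. anpe_outputs d grad H x0 \<eta>0 w" by (rule outputs_exist)
    next
      fix w \<epsilon> assume "anpe_outputs d grad H x0 \<eta>0 w" and \<epsilon>: "0 < (\<epsilon>::real)"
      then obtain X where X: "run X" "\<And>k. 1 \<le> k \<Longrightarrow> w k = output_point (X k)"
        by (auto simp: anpe_outputs_def run_def)
      let ?Q = "B * (1 + log_plus (?DR / max \<epsilon> \<epsilon>tr))
        + (M0 * R^3 / \<epsilon>) powr (2/7) + sqrt (\<delta> * R^2 / \<epsilon>)"
      obtain N where N: "1 \<le> N" "gap (X N) \<le> \<epsilon>" "real N \<le> 7000001 * ?Q"
        using accuracy[OF X(1) \<epsilon>] by blast
      have "7000001 * ?Q \<le> ?C * ?Q"
        using B1 \<epsilon> \<delta>_nonneg log_plus_nonneg[of "?DR / max \<epsilon> \<epsilon>tr"]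
        by (intro mult_right_mono add_nonneg_nonneg mult_nonneg_nonneg) auto
      then show "\<exists>N\<ge>1. f (w N) - f xs \<le> \<epsilon> \<and> real N \<le> ?C * ?Q"
        using N X(2)[OF N(1)] by (intro exI[of _ N]) auto
    next
      fix w assume "anpe_outputs d grad H x0 \<eta>0 w"
      then obtain X where X: "run X" "\<And>k. 1 \<le> k \<Longrightarrow> w k = output_point (X k)"
        by (auto simp: anpe_outputs_def run_def)
      define l where "l = max 1 (ln (?DR / \<epsilon>tr))"
      define m where "m = Suc (nat \<lfloor>7000000 * (B * (1 + log_plus (?DR / \<epsilon>tr)))\<rfloor>)"
      define K where "K = (if 0 < \<epsilon>tr then enat m else \<infinity>)"
      have "1 \<le> m" by (simp add: m_def)
      have m: "7000000 * (B * (1 + log_plus (?DR / \<epsilon>tr))) < real m" "real m \<le> 14000001 * (B * l)"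
      proof -
        have pos: "0 \<le> 7000000 * (B * (1 + log_plus (?DR / \<epsilon>tr)))"
          using B1 log_plus_nonneg[of "?DR / \<epsilon>tr"] by simp
        have m_floor: "real m = real_of_int \<lfloor>7000000 * (B * (1 + log_plus (?DR / \<epsilon>tr)))\<rfloor> + 1"
          using pos unfolding m_def by simp
        then show "7000000 * (B * (1 + log_plus (?DR / \<epsilon>tr))) < real m"
          by linarith
        have "real m \<le> 7000000 * (B * (1 + log_plus (?DR / \<epsilon>tr))) + 1"
          using m_floor by linarith
        moreover have "B * (1 + log_plus (?DR / \<epsilon>tr)) \<le> B * (2 * l)"
          using B1 by (intro mult_left_mono) (auto simp: log_plus_def l_def)
        moreover have "1 * 1 \<le> B * l" using B1 by (intro mult_mono) (auto simp: l_def)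
        ultimately show "real m \<le> 14000001 * (B * l)" by simp
      qed
      show "\<exists>K::enat. 1 \<le> K \<and>
           (\<epsilon>tr > 0 \<longrightarrow>
              (\<exists>m. K = enat m \<and> real m \<le> ?C * B * max 1 (ln (max \<eta>0 \<tau>0 * R^2 / \<epsilon>tr)))) \<and>
           (\<forall>k\<ge>1. enat k < K \<longrightarrow>
              f (w k) - f xs \<le> ?C * max \<eta>0 \<tau>0 * R^2 * exp (- (?c * (real k - 1) / B))) \<and>
           (\<forall>m. K = enat m \<longrightarrow> (\<forall>n.
              f (w (m + n)) - f xs
                \<le> ?C * (M0 * R^3 / (B + real n) powr (7/2) + \<delta> * R^2 / (B + real n)^2)))"
      proof (rule exI[of _ K], intro conjI allI impI)
        show "1 \<le> K" using \<open>1 \<le> m\<close> by (simp add: K_def one_enat_def)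
      next
        assume "0 < \<epsilon>tr"
        have "14000001 * (B * l) \<le> ?C * (B * l)"
          using B1 by (intro mult_right_mono) (auto simp: l_def)
        then show "\<exists>m. K = enat m \<and> real m \<le> ?C * B * max 1 (ln (?DR / \<epsilon>tr))"
          using m(2) \<open>0 < \<epsilon>tr\<close> unfolding l_def by (intro exI[of _ m]) (simp add: K_def mult.assoc)
      next
        fix k assume k: "1 \<le> k" "enat k < K"
        have "real k - 1 \<le> 14000001 * (B * max 1 (ln (?DR / \<epsilon>tr)))" if "0 < \<epsilon>tr"
          using k that m(2) unfolding l_def K_def by simp
        from linear[OF X(1) k(1) this]
        have "f (w k) - f xs \<le> 6 * ?DR * exp (- (?c * (real k - 1) / B))"
          using X(2)[OF k(1)] by simp
        also have "\<dots> \<le> ?C * ?DR * exp (- (?c * (real k - 1) / B))"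
          using D by (intro mult_right_mono) auto
        finally show "f (w k) - f xs \<le> ?C * max \<eta>0 \<tau>0 * R^2 * exp (- (?c * (real k - 1) / B))"
          by (simp add: mult.assoc)
      next
        fix j n assume j: "K = enat j"
        then have "0 < \<epsilon>tr" "j = m" by (auto simp: K_def split: if_splits)
        then show "f (w (j + n)) - f xs
            \<le> ?C * (M0 * R^3 / (B + real n) powr (7/2) + \<delta> * R^2 / (B + real n)^2)"
          using sublinear[OF X(1) _ m(1), of n] X(2)[of "m + n"] \<open>1 \<le> m\<close> by simp
      qed
    qed
  qed
  show ?thesis
  proof (rule exI[of _ ?C], rule exI[of _ ?c], rule conjI, simp, rule conjI, simp,
      (rule allI)+, (rule impI)+)
  qed (rule universal; assumption)
qed

end
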